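(* (Nonzero surface tension, linear diffusion case.) Let $\alpha>0$ and take exponents $\beta=k=\alpha$, $q=2\alpha$. Let $P_0,R_0,T_0>0$, $\sigma'\ge0$, $\gamma>1$, $0<X<1$ be constants, $s=R_0^3-X+1$, $\rho_0=1/s$, $P_{20}=P_0+2\sigma'/R_0$, and $$a_0=\frac{(9R_0P_0+12\sigma')^{1/2}s}{3R_0^2}.$$ Let $\rho^{(1)}(\xi,\tau)$ be an arbitrary smooth solution of the diffusion equation $\rho^{(1)}_\tau=A\rho^{(1)}_{\xi\xi}$ with $$A=\frac{\left(P_0^2R_0^5+R_0^4\left(4P_0\sigma'+\frac{13}{3}T_0\right)+4R_0^3\sigma'^2+\left[(P_0R_0+2\sigma')^2+\frac43R_0T_0\right](1-X)\right)s}{6R_0^4T_0}.$$ Let $$u^{(1)}=\frac{a_0}{\rho_0}\rho^{(1)},\quad R^{(1)}=-\frac{s^2}{3R_0^2}\rho^{(1)},\quad P_2^{(1)}=-\frac{3(P_0R_0+2\sigma')}{R_0^2}R^{(1)},\quad P^{(1)}=P_2^{(1)}+\frac{2\sigma'}{R_0^2}R^{(1)},$$ and let $\rho^{(2)}(\xi,\tau)$ be smooth. Then there exist smooth functions $u^{(2)},P^{(2)},P_2^{(2)},R^{(2)}$ of $(\xi,\tau)$ such that for the truncated expansions $$\rho=\rho_0+\epsilon^q\rho^{(1)}+\epsilon^{q+k}\rho^{(2)},\quad u=\epsilon^qu^{(1)}+\epsilon^{q+k}u^{(2)},\quad R=R_0+\epsilon^qR^{(1)}+\epsilon^{q+k}R^{(2)},$$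 $$P=P_0+\epsilon^qP^{(1)}+\epsilon^{q+k}P^{(2)},\quad P_2=P_{20}+\epsilon^qP_2^{(1)}+\epsilon^{q+k}P_2^{(2)}$$ the following holds for each fixed $(\xi,\tau)$ as $\epsilon\to0^+$: the coefficients of $\epsilon^{\alpha+q}$ and $\epsilon^{\alpha+q+k}$ in the residuals $E_1,E_2$ and of $\epsilon^q$ and $\epsilon^{q+k}$ in $E_3,E_4,E_5$ vanish, so that $E_1,E_2=O(\epsilon^{5\alpha})$ and $E_3,E_4,E_5=O(\epsilon^{4\alpha})$.
   Context: Residuals of the dimensionless one-dimensional bubbly fluid system with bubble surface tension parameter $\sigma'$ (no gravity), with $\mathcal{D}_t=\partial_t+u\partial_x$: $$E_1=\rho_t+(\rho u)_x,\qquad E_2=(\rho u)_t+(\rho u^2+P)_x-u_{xx},$$ $$E_3=P-P_2+R\,\mathcal{D}_t^2R+\tfrac32(\mathcal{D}_tR)^2+\tfrac43\frac{\mathcal{D}_tR}{R}+\frac{2\sigma'}{R},$$ $$E_4=\mathcal{D}_tP_2+3\gamma P_2\frac{\mathcal{D}_tR}{R}+3(\gamma-1)\frac{T_0}{R}\left(\frac{P_2R^3}{P_{20}R_0^3}-1\right),\qquad E_5=(1-X+R^3)\rho-1.$$ Here $P_{20}=P_0+2\sigma'/R_0$ is the equilibrium (initial) gas pressure. Gardner–Morikawa variables: $\xi=\epsilon^\alpha(x-a_0t)$, $\tau=\epsilon^{\alpha+\beta}t$, so that on functions of $(\xi,\tau)$ one has $\partial_x=\epsilon^\alpha\partial_\xi$,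 $\partial_t=-a_0\epsilon^\alpha\partial_\xi+\epsilon^{\alpha+\beta}\partial_\tau$. All coefficient functions are smooth functions of $(\xi,\tau)\in\mathbb{R}\times J$, $J$ an open interval; subscripts $\xi,\tau$ denote partial derivatives. *)

theory Defs
  imports "HOL-Analysis.Analysis" "HOL-Library.Landau_Symbols"
begin

section \<open>Smooth functions and partial derivatives\<close>

text \<open>\<open>Ck_on n S f\<close> is meant for open \<open>S\<close>: all partial derivatives of order at most \<open>n\<close> exist and
  are continuous on \<open>S\<close>.\<close>

fun Ck_on :: "nat \<Rightarrow> 'a::euclidean_space set \<Rightarrow> ('a \<Rightarrow> real) \<Rightarrow> bool" where
  "Ck_on 0 S f \<longleftrightarrow> continuous_on S f"
| "Ck_on (Suc n) S f \<longleftrightarrow> (\<forall>x\<in>S. f differentiable (at x)) \<and>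
     (\<forall>i\<in>Basis. Ck_on n S (\<lambda>x. frechet_derivative f (at x) i))"

definition smooth_on :: "'a::euclidean_space set \<Rightarrow> ('a \<Rightarrow> real) \<Rightarrow> bool" where
  "smooth_on S f \<longleftrightarrow> (\<forall>n. Ck_on n S f)"

definition smooth_strip :: "real set \<Rightarrow> (real \<Rightarrow> real \<Rightarrow> real) \<Rightarrow> bool" where
  "smooth_strip J f \<longleftrightarrow> smooth_on (UNIV \<times> J) (\<lambda>(\<xi>, \<tau>). f \<xi> \<tau>)"

definition pd1 :: "(real \<Rightarrow> real \<Rightarrow> real) \<Rightarrow> real \<Rightarrow> real \<Rightarrow> real" where
  "pd1 f a b = deriv (\<lambda>y. f y b) a"

definition pd2 :: "(real \<Rightarrow> real \<Rightarrow> real) \<Rightarrow> real \<Rightarrow> real \<Rightarrow> real" where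
  "pd2 f a b = deriv (\<lambda>y. f a y) b"

section \<open>Residuals of the bubbly fluid system\<close>

text \<open>The fields are functions of the physical variables \<open>(x, t)\<close>. The liquid pressure is \<open>P\<close>;
  the gas pressure in the bubbles (usually written with index 2) is \<open>G\<close>, its equilibrium
  value is \<open>G0\<close>.\<close>

definition mat_deriv :: "(real \<Rightarrow> real \<Rightarrow> real) \<Rightarrow> (real \<Rightarrow> real \<Rightarrow> real) \<Rightarrow> real \<Rightarrow> real \<Rightarrow> real" where
  "mat_deriv u f x t = pd2 f x t + u x t * pd1 f x t"

definition res_mass ::
  "(real \<Rightarrow> real \<Rightarrow> real) \<Rightarrow> (real \<Rightarrow> real \<Rightarrow> real) \<Rightarrow> real \<Rightarrow> real \<Rightarrow> real" where
  "res_mass \<rho> u x t = pd2 \<rho> x t + pd1 (\<lambda>x t. \<rho> x t * u x t) x t"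

definition res_momentum ::
  "(real \<Rightarrow> real \<Rightarrow> real) \<Rightarrow> (real \<Rightarrow> real \<Rightarrow> real) \<Rightarrow> (real \<Rightarrow> real \<Rightarrow> real) \<Rightarrow>
   real \<Rightarrow> real \<Rightarrow> real" where
  "res_momentum \<rho> u P x t =
     pd2 (\<lambda>x t. \<rho> x t * u x t) x t + pd1 (\<lambda>x t. \<rho> x t * (u x t)\<^sup>2 + P x t) x t - pd1 (pd1 u) x t"

definition res_bubble ::
  "real \<Rightarrow> (real \<Rightarrow> real \<Rightarrow> real) \<Rightarrow> (real \<Rightarrow> real \<Rightarrow> real) \<Rightarrow> (real \<Rightarrow> real \<Rightarrow> real) \<Rightarrow>
   (real \<Rightarrow> real \<Rightarrow> real) \<Rightarrow> real \<Rightarrow> real \<Rightarrow> real" where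
  "res_bubble \<sigma> u P G R x t =
     P x t - G x t + R x t * mat_deriv u (mat_deriv u R) x t + 3/2 * (mat_deriv u R x t)\<^sup>2
       + 4/3 * (mat_deriv u R x t / R x t) + 2 * \<sigma> / R x t"

definition res_gas ::
  "real \<Rightarrow> real \<Rightarrow> real \<Rightarrow> real \<Rightarrow> (real \<Rightarrow> real \<Rightarrow> real) \<Rightarrow> (real \<Rightarrow> real \<Rightarrow> real) \<Rightarrow>
   (real \<Rightarrow> real \<Rightarrow> real) \<Rightarrow> real \<Rightarrow> real \<Rightarrow> real" where
  "res_gas \<gamma> T0 G0 R0 u G R x t =
     mat_deriv u G x t + 3 * \<gamma> * G x t * (mat_deriv u R x t / R x t)
       + 3 * (\<gamma> - 1) * (T0 / R x t) * (G x t * R x t ^ 3 / (G0 * R0 ^ 3) - 1)"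

definition res_volume ::
  "real \<Rightarrow> (real \<Rightarrow> real \<Rightarrow> real) \<Rightarrow> (real \<Rightarrow> real \<Rightarrow> real) \<Rightarrow> real \<Rightarrow> real \<Rightarrow> real" where
  "res_volume X \<rho> R x t = (1 - X + R x t ^ 3) * \<rho> x t - 1"

section \<open>Gardner--Morikawa variables and truncated expansions\<close>

definition gm_field ::
  "real \<Rightarrow> real \<Rightarrow> real \<Rightarrow> real \<Rightarrow> (real \<Rightarrow> real \<Rightarrow> real) \<Rightarrow> real \<Rightarrow> real \<Rightarrow> real" where
  "gm_field \<alpha> \<beta> a0 \<epsilon> f x t = f (\<epsilon> powr \<alpha> * (x - a0 * t)) (\<epsilon> powr (\<alpha> + \<beta>) * t)"

text \<open>The value of a function of \<open>(x, t)\<close> at the physical point whose Gardner--Morikawa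
  coordinates are \<open>(\<xi>, \<tau>)\<close>, for \<open>\<epsilon> > 0\<close>; see \<open>gm_at_gm_field\<close> below.\<close>

definition gm_at ::
  "real \<Rightarrow> real \<Rightarrow> real \<Rightarrow> real \<Rightarrow> (real \<Rightarrow> real \<Rightarrow> real) \<Rightarrow> real \<Rightarrow> real \<Rightarrow> real" where
  "gm_at \<alpha> \<beta> a0 \<epsilon> F \<xi> \<tau> =
     F (\<xi> / \<epsilon> powr \<alpha> + a0 * (\<tau> / \<epsilon> powr (\<alpha> + \<beta>))) (\<tau> / \<epsilon> powr (\<alpha> + \<beta>))"

lemma gm_at_gm_field: "\<epsilon> > 0 \<Longrightarrow> gm_at \<alpha> \<beta> a0 \<epsilon> (gm_field \<alpha> \<beta> a0 \<epsilon> f) \<xi> \<tau> = f \<xi> \<tau>"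
  by (simp add: gm_at_def gm_field_def)

definition truncated ::
  "real \<Rightarrow> real \<Rightarrow> real \<Rightarrow> (real \<Rightarrow> real \<Rightarrow> real) \<Rightarrow> (real \<Rightarrow> real \<Rightarrow> real) \<Rightarrow>
   real \<Rightarrow> real \<Rightarrow> real \<Rightarrow> real" where
  "truncated q k f0 f1 f2 \<epsilon> \<xi> \<tau> = f0 + \<epsilon> powr q * f1 \<xi> \<tau> + \<epsilon> powr (q + k) * f2 \<xi> \<tau>"

section \<open>Coefficients of asymptotic expansions\<close>

text \<open>\<open>F\<close> has, as \<open>\<epsilon> \<rightarrow> 0\<^sup>+\<close>, an asymptotic expansion in finitely many real powers of \<open>\<epsilon>\<close> up to and
  including \<open>\<epsilon>\<^sup>p\<close>, and \<open>c\<close> is the coefficient of \<open>\<epsilon>\<^sup>p\<close> in it.\<close>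

definition has_eps_coeff :: "(real \<Rightarrow> real) \<Rightarrow> real \<Rightarrow> real \<Rightarrow> bool" where
  "has_eps_coeff F p c \<longleftrightarrow>
     (\<exists>S a. finite S \<and> S \<subseteq> {..p} \<and> p \<in> S \<and> a p = c \<and>
        (\<lambda>\<epsilon>. F \<epsilon> - (\<Sum>s\<in>S. a s * \<epsilon> powr s)) \<in> o[at_right 0](\<lambda>\<epsilon>. \<epsilon> powr p))"

lemma powr_smallo_powr_at_right_0:
  "(\<lambda>\<epsilon>::real. \<epsilon> powr s) \<in> o[at_right 0](\<lambda>\<epsilon>. \<epsilon> powr b)" if "b < s" for s b :: real
proof (rule smalloI_tendsto)
  have "((\<lambda>\<epsilon>::real. \<epsilon>) \<longlongrightarrow> 0) (at_right 0)"
    by (rule tendsto_ident_at)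
  then have "((\<lambda>\<epsilon>::real. \<epsilon> powr (s - b)) \<longlongrightarrow> 0) (at_right 0)"
    by (rule tendsto_zero_powrI[where b = "s - b"])
       (use that in \<open>auto intro: eventually_mono[OF eventually_at_right_less]\<close>)
  moreover have "\<forall>\<^sub>F \<epsilon>::real in at_right 0. \<epsilon> powr (s - b) = \<epsilon> powr s / \<epsilon> powr b"
    by (simp add: powr_diff)
  ultimately show "((\<lambda>\<epsilon>::real. \<epsilon> powr s / \<epsilon> powr b) \<longlongrightarrow> 0) (at_right 0)"
    by (rule Lim_transform_eventually)
  show "\<forall>\<^sub>F \<epsilon>::real in at_right 0. \<epsilon> powr b \<noteq> 0"
    using eventually_at_right_less[of "0::real"] by eventually_elim simp
qed

lemma eps_powers_independent:
  fixes a :: "real \<Rightarrow> real"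
  assumes "finite S" "S \<subseteq> {..p}"
    and "(\<lambda>\<epsilon>. \<Sum>s\<in>S. a s * \<epsilon> powr s) \<in> o[at_right 0](\<lambda>\<epsilon>. \<epsilon> powr p)"
  shows "\<forall>s\<in>S. a s = 0"
  using assms
proof (induction S rule: finite_linorder_min_induct)
  case empty
  then show ?case by simp
next
  case (insert b A)
  let ?B = "\<lambda>\<epsilon>::real. \<epsilon> powr b"
  have nin: "b \<notin> A" using insert.hyps(2) by auto
  have tail: "(\<lambda>\<epsilon>. \<Sum>s\<in>A. a s * \<epsilon> powr s) \<in> o[at_right 0](?B)"
    using insert.hyps(2)
    by (intro big_sum_in_smallo) (simp add: powr_smallo_powr_at_right_0)
  have "b \<le> p" using insert.prems by auto
  then have "(\<lambda>\<epsilon>::real. \<epsilon> powr p) \<in> O[at_right 0](?B)"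
    using landau_o.small_imp_big[OF powr_smallo_powr_at_right_0, of b p] by (cases "b = p") auto
  then have all: "(\<lambda>\<epsilon>. a b * \<epsilon> powr b + (\<Sum>s\<in>A. a s * \<epsilon> powr s)) \<in> o[at_right 0](?B)"
    using insert.prems(2) insert.hyps(1) nin by (auto intro: landau_o.small_big_trans)
  have "(\<lambda>\<epsilon>. a b * \<epsilon> powr b) \<in> o[at_right 0](?B)"
    using sum_in_smallo(2)[OF all tail] by simp
  moreover have "\<forall>\<^sub>F \<epsilon>::real in at_right 0. \<epsilon> powr b \<noteq> 0"
    using eventually_at_right_less[of "0::real"] by eventually_elim simp
  ultimately have "((\<lambda>\<epsilon>. a b * \<epsilon> powr b / \<epsilon> powr b) \<longlongrightarrow> 0) (at_right 0)"
    by (intro smalloD_tendsto)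
  moreover have "\<forall>\<^sub>F \<epsilon>::real in at_right 0. a b * \<epsilon> powr b / \<epsilon> powr b = a b"
    using eventually_at_right_less[of "0::real"] by eventually_elim simp
  ultimately have "((\<lambda>_::real. a b) \<longlongrightarrow> 0) (at_right 0)"
    by (rule Lim_transform_eventually)
  then have z: "a b = 0"
    by (simp add: tendsto_const_iff)
  then show ?case using insert nin by simp
qed

lemma has_eps_coeff_unique:
  assumes "has_eps_coeff F p c" "has_eps_coeff F p d"
  shows "c = d"
proof -
  obtain S a where S: "finite S" "S \<subseteq> {..p}" "p \<in> S" "a p = c"
    "(\<lambda>\<epsilon>. F \<epsilon> - (\<Sum>s\<in>S. a s * \<epsilon> powr s)) \<in> o[at_right 0](\<lambda>\<epsilon>. \<epsilon> powr p)"
    using assms(1) unfolding has_eps_coeff_def by blast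
  obtain T b where T: "finite T" "T \<subseteq> {..p}" "p \<in> T" "b p = d"
    "(\<lambda>\<epsilon>. F \<epsilon> - (\<Sum>s\<in>T. b s * \<epsilon> powr s)) \<in> o[at_right 0](\<lambda>\<epsilon>. \<epsilon> powr p)"
    using assms(2) unfolding has_eps_coeff_def by blast
  define e where "e s = (if s \<in> T then b s else 0) - (if s \<in> S then a s else 0)" for s
  have eq: "(\<Sum>s\<in>S \<union> T. e s * \<epsilon> powr s) =
      (\<Sum>s\<in>T. b s * \<epsilon> powr s) - (\<Sum>s\<in>S. a s * \<epsilon> powr s)" for \<epsilon> :: real
  proof -
    have "(\<Sum>s\<in>S \<union> T. (if s \<in> T then b s else 0) * \<epsilon> powr s) = (\<Sum>s\<in>T. b s * \<epsilon> powr s)"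
      using S(1) T(1) by (intro sum.mono_neutral_cong_right) auto
    moreover have "(\<Sum>s\<in>S \<union> T. (if s \<in> S then a s else 0) * \<epsilon> powr s) = (\<Sum>s\<in>S. a s * \<epsilon> powr s)"
      using S(1) T(1) by (intro sum.mono_neutral_cong_right) auto
    ultimately show ?thesis
      by (simp add: e_def left_diff_distrib sum_subtractf)
  qed
  have "(\<lambda>\<epsilon>. \<Sum>s\<in>S \<union> T. e s * \<epsilon> powr s) \<in> o[at_right 0](\<lambda>\<epsilon>. \<epsilon> powr p)"
    using sum_in_smallo(2)[OF S(5) T(5)] by (simp add: eq)
  then have "\<forall>s\<in>S \<union> T. e s = 0"
    using S T by (intro eps_powers_independent) auto
  then have "e p = 0" using S(3) by blast
  then show ?thesis using S T by (simp add: e_def)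
qed

end

theory Submission
  imports Defs
begin

text \<open>
  Put \<open>\<delta> = \<epsilon>\<^sup>\<alpha>\<close>. At a fixed point \<open>(\<xi>, \<tau>)\<close> each residual is a rational function of \<open>\<delta>\<close> whose
  denominator does not vanish at \<open>0\<close>, and cancelling its two lowest orders leaves \<open>\<delta>\<^sup>5\<close> resp. \<open>\<delta>\<^sup>4\<close> times a
  function that is continuous at \<open>0\<close>; in particular all lower coefficients are zero. The lowest order
  is the relation between the first-order fields. At the next order, the volume, mass, gas
  and momentum equations are solved, in turn, by \<open>R2 = - s\<^sup>2 / (3 R0\<^sup>2) \<rho>2\<close>,
  \<open>u2 = s (a0 \<rho>2 - A \<rho>1\<^sub>\<xi>)\<close>, \<open>G2 = - (3 G0 / R0) R2 + (a0 G0\<^sup>2 / T0) R1\<^sub>\<xi>\<close> and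
  \<open>P2 = a0\<^sup>2 \<rho>2 + (a0 s - 2 a0 A) \<rho>1\<^sub>\<xi>\<close>. The bubble equation remains as a compatibility condition:
  its coefficient of \<open>\<rho>2\<close> fixes \<open>a0\<close>, and its coefficient of \<open>\<rho>1\<^sub>\<xi>\<close> fixes \<open>A\<close>.
\<close>

section \<open>Smooth functions\<close>

text \<open>Openness turns equality on \<open>S\<close> into equality near each of its points, so
  the Frechet derivatives agree there and the induction passes to them.\<close>

lemma Ck_on_cong:
  assumes "open S" "\<And>x. x \<in> S \<Longrightarrow> f x = g x" "Ck_on n S f"
  shows "Ck_on n S g"
  using assms(2,3)
proof (induction n arbitrary: f g)
  case 0
  then show ?case by (simp cong: continuous_on_cong)
next
  case (Suc n)
  have d: "(g has_derivative frechet_derivative f (at x)) (at x)" if "x \<in> S" for x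
    using that Suc.prems assms(1)
    by (auto intro: has_derivative_transform_within_open simp: frechet_derivative_works)
  then have eq: "frechet_derivative f (at x) = frechet_derivative g (at x)" if "x \<in> S" for x
    using that by (intro frechet_derivative_at)
  have "Ck_on n S (\<lambda>x. frechet_derivative g (at x) i)" if "i \<in> Basis" for i
    by (rule Suc.IH[of "\<lambda>x. frechet_derivative f (at x) i"]) (use Suc.prems that eq in auto)
  then show ?case
    using differentiableI[OF d] by simp
qed

text \<open>Each first- and second-order field is a constant-coefficient combination of at most two
  of \<open>\<rho>1\<close>, \<open>\<rho>2\<close> and \<open>pd1 \<rho>1\<close>. This closure
  property, together with closure under partial derivatives, gives the smoothness of all of
  them.\<close>

lemma Ck_on_linear_combination:
  assumes "open S" "Ck_on n S f" "Ck_on n S g"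
  shows "Ck_on n S (\<lambda>x. a * f x + b * g x)"
  using assms(2,3)
proof (induction n arbitrary: f g)
  case 0
  then show ?case by (auto intro!: continuous_intros)
next
  case (Suc n)
  have d: "((\<lambda>x. a * f x + b * g x) has_derivative
      (\<lambda>h. a * frechet_derivative f (at x) h + b * frechet_derivative g (at x) h)) (at x)"
    if "x \<in> S" for x
    using that Suc.prems
    by (auto intro!: has_derivative_add has_derivative_mult_right simp: frechet_derivative_works)
  have "Ck_on n S (\<lambda>x. frechet_derivative (\<lambda>x. a * f x + b * g x) (at x) i)"
    if "i \<in> Basis" for i
  proof (rule Ck_on_cong[OF assms(1)])
    show "Ck_on n S (\<lambda>x. a * frechet_derivative f (at x) i + b * frechet_derivative g (at x) i)"
      using Suc that by auto
    show "a * frechet_derivative f (at x) i + b * frechet_derivative g (at x) i =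
        frechet_derivative (\<lambda>x. a * f x + b * g x) (at x) i" if "x \<in> S" for x
      unfolding frechet_derivative_at[OF d[OF that], symmetric] ..
  qed
  then show ?case
    using differentiableI[OF d] by simp
qed

section \<open>Partial derivatives on a strip\<close>

text \<open>Total differentiability, not mere existence of partial derivatives, is recorded so that
  the chain rule holds along curves. The partials are arguments, so that the rules below compute
  them symbolically.\<close>

definition strip_deriv ::
  "real set \<Rightarrow> (real \<Rightarrow> real \<Rightarrow> real) \<Rightarrow> (real \<Rightarrow> real \<Rightarrow> real) \<Rightarrow> (real \<Rightarrow> real \<Rightarrow> real) \<Rightarrow> bool" where
  "strip_deriv J f fx ft \<longleftrightarrow> (\<forall>\<xi>. \<forall>\<tau>\<in>J.
     ((\<lambda>z. f (fst z) (snd z)) has_derivative (\<lambda>h. fst h * fx \<xi> \<tau> + snd h * ft \<xi> \<tau>)) (at (\<xi>, \<tau>)))"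

text \<open>In the coordinates \<open>(\<xi>, \<tau>)\<close>, lines of constant \<open>t\<close> or
  constant \<open>x\<close> become such curves \<open>(a y, b y)\<close>.\<close>

lemma strip_deriv_compose:
  assumes "strip_deriv J f fx ft" "b y \<in> J"
    and "(a has_real_derivative a') (at y)" "(b has_real_derivative b') (at y)"
  shows "((\<lambda>y. f (a y) (b y)) has_real_derivative a' * fx (a y) (b y) + b' * ft (a y) (b y)) (at y)"
proof -
  have ab: "((\<lambda>y. (a y, b y)) has_derivative (\<lambda>h. (a' * h, b' * h))) (at y)"
    using assms(3,4) by (auto intro!: has_derivative_Pair simp: has_field_derivative_def)
  have "((\<lambda>z. f (fst z) (snd z)) has_derivative
      (\<lambda>h. fst h * fx (a y) (b y) + snd h * ft (a y) (b y))) (at (a y, b y))"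
    using assms(1,2) by (simp add: strip_deriv_def)
  from has_derivative_compose[OF ab this]
  have "((\<lambda>y. f (a y) (b y)) has_derivative (\<lambda>h. a' * h * fx (a y) (b y) + b' * h * ft (a y) (b y))) (at y)"
    by simp
  then show ?thesis
    unfolding has_field_derivative_def
    by (rule has_derivative_eq_rhs) (simp add: fun_eq_iff algebra_simps)
qed

lemma strip_deriv_pd:
  assumes "strip_deriv J f fx ft" "\<tau> \<in> J"
  shows "pd1 f \<xi> \<tau> = fx \<xi> \<tau>" "pd2 f \<xi> \<tau> = ft \<xi> \<tau>"
  using strip_deriv_compose[OF assms(1), of "\<lambda>_. \<tau>" \<xi> "\<lambda>y. y" 1 0]
    strip_deriv_compose[OF assms(1), of "\<lambda>y. y" \<tau> "\<lambda>_. \<xi>" 0 1] assms(2)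
  by (auto simp: pd1_def pd2_def intro!: DERIV_imp_deriv)

lemma strip_deriv_const: "strip_deriv J (\<lambda>\<xi> \<tau>. c) (\<lambda>\<xi> \<tau>. 0) (\<lambda>\<xi> \<tau>. 0)"
  by (simp add: strip_deriv_def)

lemma strip_deriv_add:
  assumes "strip_deriv J f fx ft" "strip_deriv J g gx gt"
  shows "strip_deriv J (\<lambda>\<xi> \<tau>. f \<xi> \<tau> + g \<xi> \<tau>) (\<lambda>\<xi> \<tau>. fx \<xi> \<tau> + gx \<xi> \<tau>) (\<lambda>\<xi> \<tau>. ft \<xi> \<tau> + gt \<xi> \<tau>)"
  unfolding strip_deriv_def
proof (intro allI ballI)
  fix \<xi> \<tau> assume "\<tau> \<in> J"
  with assms show "((\<lambda>z. f (fst z) (snd z) + g (fst z) (snd z)) has_derivative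
      (\<lambda>h. fst h * (fx \<xi> \<tau> + gx \<xi> \<tau>) + snd h * (ft \<xi> \<tau> + gt \<xi> \<tau>))) (at (\<xi>, \<tau>))"
    unfolding strip_deriv_def
    by (auto intro!: derivative_eq_intros simp: algebra_simps)
qed

lemma strip_deriv_mult:
  assumes "strip_deriv J f fx ft" "strip_deriv J g gx gt"
  shows "strip_deriv J (\<lambda>\<xi> \<tau>. f \<xi> \<tau> * g \<xi> \<tau>)
     (\<lambda>\<xi> \<tau>. fx \<xi> \<tau> * g \<xi> \<tau> + f \<xi> \<tau> * gx \<xi> \<tau>) (\<lambda>\<xi> \<tau>. ft \<xi> \<tau> * g \<xi> \<tau> + f \<xi> \<tau> * gt \<xi> \<tau>)"
  unfolding strip_deriv_def
proof (intro allI ballI)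
  fix \<xi> \<tau> assume "\<tau> \<in> J"
  then have "((\<lambda>z. f (fst z) (snd z)) has_derivative (\<lambda>h. fst h * fx \<xi> \<tau> + snd h * ft \<xi> \<tau>)) (at (\<xi>, \<tau>))"
    and "((\<lambda>z. g (fst z) (snd z)) has_derivative (\<lambda>h. fst h * gx \<xi> \<tau> + snd h * gt \<xi> \<tau>)) (at (\<xi>, \<tau>))"
    using assms by (auto simp: strip_deriv_def)
  from has_derivative_mult[OF this] show "((\<lambda>z. f (fst z) (snd z) * g (fst z) (snd z)) has_derivative
      (\<lambda>h. fst h * (fx \<xi> \<tau> * g \<xi> \<tau> + f \<xi> \<tau> * gx \<xi> \<tau>) + snd h * (ft \<xi> \<tau> * g \<xi> \<tau> + f \<xi> \<tau> * gt \<xi> \<tau>)))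
      (at (\<xi>, \<tau>))"
    by (simp add: algebra_simps)
qed

lemma strip_deriv_cmult:
  assumes "strip_deriv J f fx ft"
  shows "strip_deriv J (\<lambda>\<xi> \<tau>. c * f \<xi> \<tau>) (\<lambda>\<xi> \<tau>. c * fx \<xi> \<tau>) (\<lambda>\<xi> \<tau>. c * ft \<xi> \<tau>)"
  using strip_deriv_mult[OF strip_deriv_const assms] by simp

text \<open>The equilibrium constant drops out, so a derivative of a truncated expansion is again
  one, with leading term 0, and can be expanded by the same formula.\<close>

lemma strip_deriv_truncated:
  assumes "strip_deriv J f fx ft" "strip_deriv J g gx gt"
  shows "strip_deriv J (truncated q k c f g \<epsilon>) (truncated q k 0 fx gx \<epsilon>) (truncated q k 0 ft gt \<epsilon>)"
  using strip_deriv_add[OF strip_deriv_add[OF strip_deriv_const strip_deriv_cmult[OF assms(1)]]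
      strip_deriv_cmult[OF assms(2)]]
  by (simp add: truncated_def[abs_def])

lemma smooth_strip_frechet:
  assumes "smooth_strip J f"
  shows "strip_deriv J f (\<lambda>\<xi> \<tau>. frechet_derivative (\<lambda>z. f (fst z) (snd z)) (at (\<xi>, \<tau>)) (1, 0))
    (\<lambda>\<xi> \<tau>. frechet_derivative (\<lambda>z. f (fst z) (snd z)) (at (\<xi>, \<tau>)) (0, 1))"
  unfolding strip_deriv_def
proof (intro allI ballI)
  fix \<xi> \<tau> assume "\<tau> \<in> J"
  let ?D = "frechet_derivative (\<lambda>z. f (fst z) (snd z)) (at (\<xi>, \<tau>))"
  have "Ck_on (Suc 0) (UNIV \<times> J) (\<lambda>z. f (fst z) (snd z))"
    using assms unfolding smooth_strip_def smooth_on_def case_prod_unfold by blast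
  with \<open>\<tau> \<in> J\<close> have D: "((\<lambda>z. f (fst z) (snd z)) has_derivative ?D) (at (\<xi>, \<tau>))"
    by (auto simp flip: frechet_derivative_works)
  interpret linear ?D using D by (rule has_derivative_linear)
  \<comment> \<open>A linear map on the plane is determined by its values at the two unit vectors.
    Homogeneity has to extract the scalars before they are multiplied into the pairs, so
    \<open>scaleR_Pair\<close> is withheld at first.\<close>
  have "?D h = fst h * ?D (1, 0) + snd h * ?D (0, 1)" for h
    using add[of "fst h *\<^sub>R (1, 0)" "snd h *\<^sub>R (0, 1)"]
    by (simp add: scale del: scaleR_Pair) (simp add: scaleR_Pair)
  then have "?D = (\<lambda>h. fst h * ?D (1, 0) + snd h * ?D (0, 1))" by blast
  with D show "((\<lambda>z. f (fst z) (snd z)) has_derivative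
      (\<lambda>h. fst h * ?D (1, 0) + snd h * ?D (0, 1))) (at (\<xi>, \<tau>))"
    by metis
qed

lemma smooth_strip_deriv:
  assumes "smooth_strip J f"
  shows "strip_deriv J f (pd1 f) (pd2 f)"
  using smooth_strip_frechet[OF assms] strip_deriv_pd[OF smooth_strip_frechet[OF assms]]
  by (auto simp: strip_deriv_def)

text \<open>A derivative costs one order, which is harmless because smoothness demands every order.
  On the open strip, \<open>pd1\<close> and \<open>pd2\<close> agree with the Frechet derivative at
  the unit vectors.\<close>

lemma smooth_strip_pd:
  assumes "open J" "smooth_strip J f"
  shows "smooth_strip J (pd1 f)" "smooth_strip J (pd2 f)"
proof -
  have S: "open (UNIV \<times> J :: (real \<times> real) set)"
    using assms(1) by (simp add: open_Times)
  have C: "Ck_on (Suc n) (UNIV \<times> J) (\<lambda>z. f (fst z) (snd z))" for n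
    using assms unfolding smooth_strip_def smooth_on_def case_prod_unfold by blast
  then have "Ck_on n (UNIV \<times> J) (\<lambda>z. frechet_derivative (\<lambda>z. f (fst z) (snd z)) (at z) i)"
    if "i \<in> Basis" for i n
    using that by simp
  then have F: "Ck_on n (UNIV \<times> J) (\<lambda>z. frechet_derivative (\<lambda>z. f (fst z) (snd z)) (at z) (1, 0))"
    "Ck_on n (UNIV \<times> J) (\<lambda>z. frechet_derivative (\<lambda>z. f (fst z) (snd z)) (at z) (0, 1))" for n
    by (auto simp: Basis_prod_def)
  note pd = strip_deriv_pd[OF smooth_strip_frechet[OF assms(2)]]
  show "smooth_strip J (pd1 f)" "smooth_strip J (pd2 f)"
    unfolding smooth_strip_def smooth_on_def case_prod_unfold
    using Ck_on_cong[OF S _ F(1), of "\<lambda>z. pd1 f (fst z) (snd z)"]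
      Ck_on_cong[OF S _ F(2), of "\<lambda>z. pd2 f (fst z) (snd z)"]
    by (auto simp: pd)
qed

lemma smooth_strip_linear_combination:
  assumes "open J" "smooth_strip J f" "smooth_strip J g"
  shows "smooth_strip J (\<lambda>\<xi> \<tau>. a * f \<xi> \<tau> + b * g \<xi> \<tau>)"
  using assms Ck_on_linear_combination[of "UNIV \<times> J" _ "\<lambda>z. f (fst z) (snd z)" "\<lambda>z. g (fst z) (snd z)"]
  unfolding smooth_strip_def smooth_on_def case_prod_unfold by (auto simp: open_Times)

lemma linear_combination_pd:
  assumes "smooth_strip J f" "smooth_strip J g" "\<tau> \<in> J"
  shows "pd1 (\<lambda>\<xi> \<tau>. a * f \<xi> \<tau> + b * g \<xi> \<tau>) \<xi> \<tau> = a * pd1 f \<xi> \<tau> + b * pd1 g \<xi> \<tau>"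
    "pd2 (\<lambda>\<xi> \<tau>. a * f \<xi> \<tau> + b * g \<xi> \<tau>) \<xi> \<tau> = a * pd2 f \<xi> \<tau> + b * pd2 g \<xi> \<tau>"
  using strip_deriv_pd[OF strip_deriv_add[OF strip_deriv_cmult[OF smooth_strip_deriv[OF assms(1)]]
    strip_deriv_cmult[OF smooth_strip_deriv[OF assms(2)]]] assms(3)] by simp_all

section \<open>Derivatives in Gardner--Morikawa variables\<close>

text \<open>\<open>F\<close> is only compared with \<open>f\<close> above \<open>J\<close>: the derivatives of \<open>F\<close> are junk elsewhere, and the
  openness of \<open>J\<close> makes this enough to iterate \<open>pd1\<close> and \<open>pd2\<close>.\<close>

definition gm_rep ::
  "real set \<Rightarrow> real \<Rightarrow> real \<Rightarrow> real \<Rightarrow> real \<Rightarrow> (real \<Rightarrow> real \<Rightarrow> real) \<Rightarrow> (real \<Rightarrow> real \<Rightarrow> real) \<Rightarrow> bool" where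
  "gm_rep J \<alpha> \<beta> c \<epsilon> F f \<longleftrightarrow> (\<forall>x t. \<epsilon> powr (\<alpha> + \<beta>) * t \<in> J \<longrightarrow> F x t = gm_field \<alpha> \<beta> c \<epsilon> f x t)"

lemma gm_rep_refl: "gm_rep J \<alpha> \<beta> c \<epsilon> (gm_field \<alpha> \<beta> c \<epsilon> f) f"
  by (simp add: gm_rep_def)

lemma gm_rep_add:
  "gm_rep J \<alpha> \<beta> c \<epsilon> F f \<Longrightarrow> gm_rep J \<alpha> \<beta> c \<epsilon> G g \<Longrightarrow>
   gm_rep J \<alpha> \<beta> c \<epsilon> (\<lambda>x t. F x t + G x t) (\<lambda>\<xi> \<tau>. f \<xi> \<tau> + g \<xi> \<tau>)"
  by (simp add: gm_rep_def gm_field_def)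

lemma gm_rep_mult:
  "gm_rep J \<alpha> \<beta> c \<epsilon> F f \<Longrightarrow> gm_rep J \<alpha> \<beta> c \<epsilon> G g \<Longrightarrow>
   gm_rep J \<alpha> \<beta> c \<epsilon> (\<lambda>x t. F x t * G x t) (\<lambda>\<xi> \<tau>. f \<xi> \<tau> * g \<xi> \<tau>)"
  by (simp add: gm_rep_def gm_field_def)

lemma gm_at_rep:
  assumes "gm_rep J \<alpha> \<beta> c \<epsilon> F f" "\<epsilon> > 0" "\<tau> \<in> J"
  shows "gm_at \<alpha> \<beta> c \<epsilon> F \<xi> \<tau> = f \<xi> \<tau>"
  using assms gm_at_gm_field[of \<epsilon> \<alpha> \<beta> c f \<xi> \<tau>]
  by (simp add: gm_at_def gm_rep_def)

text \<open>With \<open>t\<close> fixed the second Gardner--Morikawa coordinate is fixed, so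
  \<open>F\<close> is represented along the whole line and the chain rule applies directly.\<close>

lemma gm_rep_pd1:
  assumes "gm_rep J \<alpha> \<beta> c \<epsilon> F f" "strip_deriv J f fx ft"
  shows "gm_rep J \<alpha> \<beta> c \<epsilon> (pd1 F) (\<lambda>\<xi> \<tau>. \<epsilon> powr \<alpha> * fx \<xi> \<tau>)"
  unfolding gm_rep_def
proof (intro allI impI)
  fix x t assume t: "\<epsilon> powr (\<alpha> + \<beta>) * t \<in> J"
  then have eq: "(\<lambda>y. F y t) = (\<lambda>y. f (\<epsilon> powr \<alpha> * (y - c * t)) (\<epsilon> powr (\<alpha> + \<beta>) * t))"
    using assms(1) by (auto simp: gm_rep_def gm_field_def)
  have "((\<lambda>y. \<epsilon> powr \<alpha> * (y - c * t)) has_real_derivative \<epsilon> powr \<alpha>) (at x)"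
    by (auto intro!: derivative_eq_intros)
  from strip_deriv_compose[OF assms(2) _ this DERIV_const, of "\<epsilon> powr (\<alpha> + \<beta>) * t"] t
  show "pd1 F x t = gm_field \<alpha> \<beta> c \<epsilon> (\<lambda>\<xi> \<tau>. \<epsilon> powr \<alpha> * fx \<xi> \<tau>) x t"
    unfolding pd1_def eq by (auto simp: gm_field_def intro!: DERIV_imp_deriv)
qed

text \<open>Moving in \<open>t\<close> changes both coordinates, which gives the two terms. The
  representation is known only above \<open>J\<close>; openness provides a neighbourhood of
  \<open>t\<close> in which \<open>F\<close> may be replaced.\<close>

lemma gm_rep_pd2:
  assumes "gm_rep J \<alpha> \<beta> c \<epsilon> F f" "strip_deriv J f fx ft" "open J"
  shows "gm_rep J \<alpha> \<beta> c \<epsilon> (pd2 F) (\<lambda>\<xi> \<tau>. \<epsilon> powr (\<alpha> + \<beta>) * ft \<xi> \<tau> - c * \<epsilon> powr \<alpha> * fx \<xi> \<tau>)"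
  unfolding gm_rep_def
proof (intro allI impI)
  fix x t assume t: "\<epsilon> powr (\<alpha> + \<beta>) * t \<in> J"
  have "open ((\<lambda>y. \<epsilon> powr (\<alpha> + \<beta>) * y) -` J)"
    using assms(3) by (intro open_vimage continuous_intros)
  from eventually_nhds_in_open[OF this, of t] t
  have "\<forall>\<^sub>F y in nhds t. \<epsilon> powr (\<alpha> + \<beta>) * y \<in> J"
    by simp
  then have ev: "\<forall>\<^sub>F y in nhds t. F x y = f (\<epsilon> powr \<alpha> * (x - c * y)) (\<epsilon> powr (\<alpha> + \<beta>) * y)"
    by eventually_elim (use assms(1) in \<open>auto simp: gm_rep_def gm_field_def\<close>)
  have "((\<lambda>y. \<epsilon> powr \<alpha> * (x - c * y)) has_real_derivative - (c * \<epsilon> powr \<alpha>)) (at t)"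
    "((\<lambda>y. \<epsilon> powr (\<alpha> + \<beta>) * y) has_real_derivative \<epsilon> powr (\<alpha> + \<beta>)) (at t)"
    by (auto intro!: derivative_eq_intros)
  from strip_deriv_compose[OF assms(2) t this]
  have "(F x has_real_derivative gm_field \<alpha> \<beta> c \<epsilon>
      (\<lambda>\<xi> \<tau>. \<epsilon> powr (\<alpha> + \<beta>) * ft \<xi> \<tau> - c * \<epsilon> powr \<alpha> * fx \<xi> \<tau>) x t) (at t)"
    unfolding DERIV_cong_ev[OF refl ev refl] by (simp add: gm_field_def)
  then show "pd2 F x t = gm_field \<alpha> \<beta> c \<epsilon>
      (\<lambda>\<xi> \<tau>. \<epsilon> powr (\<alpha> + \<beta>) * ft \<xi> \<tau> - c * \<epsilon> powr \<alpha> * fx \<xi> \<tau>) x t"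
    by (simp add: pd2_def DERIV_imp_deriv)
qed

text \<open>The result has the same represented form as the input, so the rule can be iterated for
  the second material derivative of the radius.\<close>

lemma gm_rep_mat_deriv:
  assumes "gm_rep J \<alpha> \<beta> c \<epsilon> U u" "gm_rep J \<alpha> \<beta> c \<epsilon> F f" "strip_deriv J f fx ft" "open J"
  shows "gm_rep J \<alpha> \<beta> c \<epsilon> (mat_deriv U F)
    (\<lambda>\<xi> \<tau>. \<epsilon> powr (\<alpha> + \<beta>) * ft \<xi> \<tau> + \<epsilon> powr \<alpha> * ((u \<xi> \<tau> - c) * fx \<xi> \<tau>))"
  using gm_rep_pd1[OF assms(2,3)] gm_rep_pd2[OF assms(2-4)] assms(1)
  by (simp add: gm_rep_def gm_field_def mat_deriv_def algebra_simps)

section \<open>Orders of magnitude of the residuals\<close>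

text \<open>\<open>R\<close> stands for the denominators of \<open>E\<close>, which may vanish for large \<open>\<epsilon>\<close>.\<close>

lemma bigo_at_right_powr:
  fixes E Q R :: "real \<Rightarrow> real"
  assumes "\<alpha> > 0"
    and eq: "\<And>\<epsilon>. \<epsilon> > 0 \<Longrightarrow> R (\<epsilon> powr \<alpha>) \<noteq> 0 \<Longrightarrow> E \<epsilon> = (\<epsilon> powr \<alpha>) ^ n * Q (\<epsilon> powr \<alpha>)"
    and "isCont Q 0" "isCont R 0" "R 0 \<noteq> 0"
  shows "E \<in> O[at_right 0](\<lambda>\<epsilon>. \<epsilon> powr (real n * \<alpha>))"
proof -
  have pos: "\<forall>\<^sub>F \<epsilon>::real in at_right 0. \<epsilon> > 0"
    by (rule eventually_at_right_less)
  have lim: "((\<lambda>\<epsilon>::real. \<epsilon> powr \<alpha>) \<longlongrightarrow> 0) (at_right 0)"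
    using assms(1) pos by (intro tendsto_zero_powrI[where b = \<alpha>] tendsto_ident_at tendsto_const)
      (auto elim: eventually_mono)
  have "\<forall>\<^sub>F \<epsilon> in at_right 0. R (\<epsilon> powr \<alpha>) \<noteq> 0"
    using isCont_tendsto_compose[OF assms(4) lim] assms(5) by (rule tendsto_imp_eventually_ne)
  with pos have ev: "\<forall>\<^sub>F \<epsilon> in at_right 0. E \<epsilon> = \<epsilon> powr (real n * \<alpha>) * Q (\<epsilon> powr \<alpha>)"
    by eventually_elim (simp add: eq powr_power mult.commute)
  have "(\<lambda>\<epsilon>. Q (\<epsilon> powr \<alpha>)) \<in> O[at_right 0](\<lambda>_. 1)"
    using isCont_tendsto_compose[OF assms(3) lim] by (intro bigoI_tendsto[where c = "Q 0"]) auto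
  then have "(\<lambda>\<epsilon>. \<epsilon> powr (real n * \<alpha>) * Q (\<epsilon> powr \<alpha>)) \<in> O[at_right 0](\<lambda>\<epsilon>. \<epsilon> powr (real n * \<alpha>) * 1)"
    by (intro landau_o.big.mult_left)
  then show ?thesis
    unfolding landau_o.big.in_cong[OF ev] by simp
qed

lemma has_eps_coeff_zero:
  assumes "E \<in> O[at_right 0](\<lambda>\<epsilon>. \<epsilon> powr r)" "p < r"
  shows "has_eps_coeff E p 0"
proof -
  have "E \<in> o[at_right 0](\<lambda>\<epsilon>. \<epsilon> powr p)"
    using landau_o.big_small_trans[OF assms(1) powr_smallo_powr_at_right_0[OF assms(2)]] .
  \<comment> \<open>The one-term expansion with exponent \<open>p\<close> and coefficient 0 is a
    witness; \<open>E\<close> itself is the remainder.\<close>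
  then show ?thesis
    unfolding has_eps_coeff_def
    by (intro exI[of _ "{p}"] exI[of _ "\<lambda>_. 0"]) simp
qed


section \<open>The residuals in Gardner--Morikawa variables\<close>

lemma gm_at_res_mass:
  assumes "\<epsilon> > 0" "open J" "\<tau> \<in> J" "strip_deriv J r rx rt" "strip_deriv J u ux ut"
  shows "gm_at \<alpha> \<beta> c \<epsilon> (res_mass (gm_field \<alpha> \<beta> c \<epsilon> r) (gm_field \<alpha> \<beta> c \<epsilon> u)) \<xi> \<tau> =
    \<epsilon> powr (\<alpha> + \<beta>) * rt \<xi> \<tau> - c * \<epsilon> powr \<alpha> * rx \<xi> \<tau>
      + \<epsilon> powr \<alpha> * (rx \<xi> \<tau> * u \<xi> \<tau> + r \<xi> \<tau> * ux \<xi> \<tau>)"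
proof -
  note rep = gm_rep_add[OF gm_rep_pd2[OF gm_rep_refl assms(4,2)]
      gm_rep_pd1[OF gm_rep_mult[OF gm_rep_refl gm_rep_refl] strip_deriv_mult[OF assms(4,5)]]]
  show ?thesis
    unfolding res_mass_def[abs_def] gm_at_rep[OF rep assms(1,3)] ..
qed

lemma gm_at_res_momentum:
  assumes "\<epsilon> > 0" "open J" "\<tau> \<in> J" "strip_deriv J r rx rt" "strip_deriv J u ux ut"
    and "strip_deriv J ux uxx uxt" "strip_deriv J p px pt"
  shows "gm_at \<alpha> \<beta> c \<epsilon> (res_momentum (gm_field \<alpha> \<beta> c \<epsilon> r) (gm_field \<alpha> \<beta> c \<epsilon> u) (gm_field \<alpha> \<beta> c \<epsilon> p)) \<xi> \<tau> =
    \<epsilon> powr (\<alpha> + \<beta>) * (rt \<xi> \<tau> * u \<xi> \<tau> + r \<xi> \<tau> * ut \<xi> \<tau>)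
      - c * \<epsilon> powr \<alpha> * (rx \<xi> \<tau> * u \<xi> \<tau> + r \<xi> \<tau> * ux \<xi> \<tau>)
      + \<epsilon> powr \<alpha> * (rx \<xi> \<tau> * (u \<xi> \<tau>)\<^sup>2 + 2 * r \<xi> \<tau> * u \<xi> \<tau> * ux \<xi> \<tau> + px \<xi> \<tau>)
      - (\<epsilon> powr \<alpha>)\<^sup>2 * uxx \<xi> \<tau>"
proof -
  let ?F = "gm_field \<alpha> \<beta> c \<epsilon>"
  note uu = strip_deriv_mult[OF assms(5,5)]
  note ru = strip_deriv_mult[OF assms(4,5)]
  note 1 = gm_rep_pd2[OF gm_rep_mult[OF gm_rep_refl gm_rep_refl] ru assms(2),
      THEN gm_at_rep, OF assms(1,3), of \<alpha> \<beta> c \<xi>]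
  note 2 = gm_rep_pd1[OF gm_rep_add[OF gm_rep_mult[OF gm_rep_refl gm_rep_mult[OF gm_rep_refl gm_rep_refl]] gm_rep_refl]
      strip_deriv_add[OF strip_deriv_mult[OF assms(4) uu] assms(7)],
      THEN gm_at_rep, OF assms(1,3), of \<alpha> \<beta> c \<xi>]
  note 3 = gm_rep_pd1[OF gm_rep_pd1[OF gm_rep_refl assms(5)] strip_deriv_cmult[OF assms(6)],
      THEN gm_at_rep, OF assms(1,3), of \<alpha> \<beta> c \<xi>]
  show ?thesis
    using 1 2 3 by (simp add: gm_at_def res_momentum_def power2_eq_square algebra_simps)
qed

lemma gm_at_res_bubble:
  fixes \<alpha> \<beta> c \<epsilon> :: real
  assumes "\<epsilon> > 0" "open J" "\<tau> \<in> J" "strip_deriv J u ux ut" "strip_deriv J R Rx Rt"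
    and "strip_deriv J Rx Rxx Rxt" "strip_deriv J Rt Rtx Rtt"
  defines "\<delta> \<equiv> \<epsilon> powr \<alpha>" and "\<eta> \<equiv> \<epsilon> powr (\<alpha> + \<beta>)"
  defines "d \<equiv> \<lambda>\<xi> \<tau>. \<eta> * Rt \<xi> \<tau> + \<delta> * ((u \<xi> \<tau> - c) * Rx \<xi> \<tau>)"
  shows "gm_at \<alpha> \<beta> c \<epsilon> (res_bubble \<sigma> (gm_field \<alpha> \<beta> c \<epsilon> u) (gm_field \<alpha> \<beta> c \<epsilon> p) (gm_field \<alpha> \<beta> c \<epsilon> g)
      (gm_field \<alpha> \<beta> c \<epsilon> R)) \<xi> \<tau> =
    p \<xi> \<tau> - g \<xi> \<tau> + R \<xi> \<tau> *
      (\<eta> * (\<eta> * Rtt \<xi> \<tau> + \<delta> * (ut \<xi> \<tau> * Rx \<xi> \<tau> + (u \<xi> \<tau> - c) * Rxt \<xi> \<tau>))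
       + \<delta> * ((u \<xi> \<tau> - c) * (\<eta> * Rtx \<xi> \<tau> + \<delta> * (ux \<xi> \<tau> * Rx \<xi> \<tau> + (u \<xi> \<tau> - c) * Rxx \<xi> \<tau>))))
     + 3/2 * (d \<xi> \<tau>)\<^sup>2 + 4/3 * (d \<xi> \<tau> / R \<xi> \<tau>) + 2 * \<sigma> / R \<xi> \<tau>"
proof -
  \<comment> \<open>The second material derivative differentiates \<open>d\<close>. The mixed
    partials \<open>Rxt\<close> and \<open>Rtx\<close> stay separate, so no symmetry of second
    derivatives is invoked.\<close>
  have d': "strip_deriv J d
     (\<lambda>\<xi> \<tau>. \<eta> * Rtx \<xi> \<tau> + \<delta> * (ux \<xi> \<tau> * Rx \<xi> \<tau> + (u \<xi> \<tau> - c) * Rxx \<xi> \<tau>))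
     (\<lambda>\<xi> \<tau>. \<eta> * Rtt \<xi> \<tau> + \<delta> * (ut \<xi> \<tau> * Rx \<xi> \<tau> + (u \<xi> \<tau> - c) * Rxt \<xi> \<tau>))"
    using strip_deriv_add[OF strip_deriv_cmult[OF assms(7)]
      strip_deriv_cmult[OF strip_deriv_mult[OF strip_deriv_add[OF assms(4) strip_deriv_const] assms(6)]],
      of \<eta> \<delta> "- c"]
    by (simp add: d_def)
  have d: "gm_rep J \<alpha> \<beta> c \<epsilon> (mat_deriv (gm_field \<alpha> \<beta> c \<epsilon> u) (gm_field \<alpha> \<beta> c \<epsilon> R)) d"
    unfolding d_def \<delta>_def \<eta>_def
    by (rule gm_rep_mat_deriv[OF gm_rep_refl gm_rep_refl assms(5,2)])
  note 1 = gm_at_rep[OF d assms(1,3), of \<xi>]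
  note 2 = gm_rep_mat_deriv[OF gm_rep_refl d d' assms(2),
      THEN gm_at_rep, OF assms(1,3), of u \<xi>]
  note 3 = gm_at_gm_field[OF assms(1), of \<alpha> \<beta> c _ \<xi> \<tau>]
  show ?thesis
    using 1 2 3[of p] 3[of g] 3[of R]
    unfolding \<delta>_def[symmetric] \<eta>_def[symmetric] gm_at_def res_bubble_def by simp
qed

lemma gm_at_res_gas:
  assumes "\<epsilon> > 0" "open J" "\<tau> \<in> J" "strip_deriv J g gx gt" "strip_deriv J R Rx Rt"
  shows "gm_at \<alpha> \<beta> c \<epsilon> (res_gas \<gamma> T0 G0 R0 (gm_field \<alpha> \<beta> c \<epsilon> u) (gm_field \<alpha> \<beta> c \<epsilon> g)
      (gm_field \<alpha> \<beta> c \<epsilon> R)) \<xi> \<tau> =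
    \<epsilon> powr (\<alpha> + \<beta>) * gt \<xi> \<tau> + \<epsilon> powr \<alpha> * ((u \<xi> \<tau> - c) * gx \<xi> \<tau>)
      + 3 * \<gamma> * g \<xi> \<tau> * ((\<epsilon> powr (\<alpha> + \<beta>) * Rt \<xi> \<tau> + \<epsilon> powr \<alpha> * ((u \<xi> \<tau> - c) * Rx \<xi> \<tau>)) / R \<xi> \<tau>)
      + 3 * (\<gamma> - 1) * (T0 / R \<xi> \<tau>) * (g \<xi> \<tau> * R \<xi> \<tau> ^ 3 / (G0 * R0 ^ 3) - 1)"
proof -
  note 1 = gm_rep_mat_deriv[OF gm_rep_refl gm_rep_refl _ assms(2),
      THEN gm_at_rep, OF _ assms(1,3), of _ _ _ \<alpha> \<beta> c u \<xi>]
  note 2 = gm_at_gm_field[OF assms(1), of \<alpha> \<beta> c _ \<xi> \<tau>]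
  show ?thesis
    using 1[OF assms(4)] 1[OF assms(5)] 2[of g] 2[of R]
    unfolding gm_at_def res_gas_def by simp
qed

section \<open>Cancellation of the two lowest orders in each residual\<close>

lemma powr_double: "(x::real) powr (2 * a) = (x powr a)\<^sup>2"
  unfolding mult_2 powr_add power2_eq_square ..

text \<open>With \<open>q = 2 * \<alpha>\<close> and \<open>k = \<alpha>\<close>, every expansion is
  a polynomial in \<open>\<epsilon> powr \<alpha>\<close>.\<close>

lemma truncated_powers:
  "truncated (2 * \<alpha>) \<alpha> f0 f1 f2 \<epsilon> \<xi> \<tau> = f0 + (\<epsilon> powr \<alpha>)\<^sup>2 * (f1 \<xi> \<tau> + \<epsilon> powr \<alpha> * f2 \<xi> \<tau>)"
  unfolding truncated_def powr_add mult_2 by (simp add: power2_eq_square algebra_simps)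

text \<open>Equations \<open>1\<close> and \<open>2\<close> annihilate the coefficients of
  \<open>\<delta> ^ 3\<close> and \<open>\<delta> ^ 4\<close>. The slow time derivative carries
  \<open>\<delta>\<^sup>2\<close> instead of \<open>\<delta>\<close>, so it acts on
  \<open>r1\<close> only at the second of these orders.\<close>

lemma res_mass_bigo:
  assumes "\<alpha> > 0" "open J" "\<tau> \<in> J" and smooth: "\<forall>f\<in>{r1, r2, u1, u2}. smooth_strip J f"
    and 1: "r0 * pd1 u1 \<xi> \<tau> = c * pd1 r1 \<xi> \<tau>"
    and 2: "r0 * pd1 u2 \<xi> \<tau> = c * pd1 r2 \<xi> \<tau> - pd2 r1 \<xi> \<tau>"
  shows "(\<lambda>\<epsilon>. gm_at \<alpha> \<alpha> c \<epsilon> (res_mass (gm_field \<alpha> \<alpha> c \<epsilon> (truncated (2 * \<alpha>) \<alpha> r0 r1 r2 \<epsilon>))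
      (gm_field \<alpha> \<alpha> c \<epsilon> (truncated (2 * \<alpha>) \<alpha> 0 u1 u2 \<epsilon>))) \<xi> \<tau>)
    \<in> O[at_right 0](\<lambda>\<epsilon>. \<epsilon> powr (5 * \<alpha>))" (is "?E \<in> _")
proof -
  note D = strip_deriv_truncated[OF smooth_strip_deriv smooth_strip_deriv]
  note E = gm_at_res_mass[OF _ assms(2,3) D D, of _ r1 r2 u1 u2]
  define Q where "Q \<delta> = pd2 r2 \<xi> \<tau> + (pd1 r1 \<xi> \<tau> + \<delta> * pd1 r2 \<xi> \<tau>) * (u1 \<xi> \<tau> + \<delta> * u2 \<xi> \<tau>)
     + (r1 \<xi> \<tau> + \<delta> * r2 \<xi> \<tau>) * (pd1 u1 \<xi> \<tau> + \<delta> * pd1 u2 \<xi> \<tau>)" for \<delta>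
  have "isCont Q 0"
    unfolding Q_def by (intro continuous_intros)
  moreover have "?E \<epsilon> = (\<epsilon> powr \<alpha>) ^ 5 * Q (\<epsilon> powr \<alpha>)" if "\<epsilon> > 0" for \<epsilon>
  proof -
    define \<delta> where "\<delta> = \<epsilon> powr \<alpha>"
    have "?E \<epsilon> = \<delta> ^ 3 * (r0 * pd1 u1 \<xi> \<tau> - c * pd1 r1 \<xi> \<tau>)
        + \<delta> ^ 4 * (r0 * pd1 u2 \<xi> \<tau> - c * pd1 r2 \<xi> \<tau> + pd2 r1 \<xi> \<tau>) + \<delta> ^ 5 * Q \<delta>"
      using smooth that by (simp add: E truncated_powers powr_double flip: \<delta>_def)
        (simp add: Q_def algebra_simps eval_nat_numeral)
    then show ?thesis by (simp add: 1 2 \<delta>_def)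
  qed
  ultimately show ?thesis
    using bigo_at_right_powr[of \<alpha> "\<lambda>_. 1" ?E 5 Q] assms(1) by simp
qed

text \<open>The slow time derivative and the viscous term both start at \<open>\<delta> ^ 4\<close>,
  whereas products of perturbations start at \<open>\<delta> ^ 5\<close> and go into
  \<open>Q\<close>. This is why the resulting evolution is linear diffusion.\<close>

lemma res_momentum_bigo:
  assumes "\<alpha> > 0" "open J" "\<tau> \<in> J" and smooth: "\<forall>f\<in>{r1, r2, u1, u2, p1, p2}. smooth_strip J f"
    and 1: "pd1 p1 \<xi> \<tau> = c * r0 * pd1 u1 \<xi> \<tau>"
    and 2: "pd1 p2 \<xi> \<tau> = c * r0 * pd1 u2 \<xi> \<tau> - r0 * pd2 u1 \<xi> \<tau> + pd1 (pd1 u1) \<xi> \<tau>"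
  shows "(\<lambda>\<epsilon>. gm_at \<alpha> \<alpha> c \<epsilon> (res_momentum (gm_field \<alpha> \<alpha> c \<epsilon> (truncated (2 * \<alpha>) \<alpha> r0 r1 r2 \<epsilon>))
      (gm_field \<alpha> \<alpha> c \<epsilon> (truncated (2 * \<alpha>) \<alpha> 0 u1 u2 \<epsilon>))
      (gm_field \<alpha> \<alpha> c \<epsilon> (truncated (2 * \<alpha>) \<alpha> p0 p1 p2 \<epsilon>))) \<xi> \<tau>)
    \<in> O[at_right 0](\<lambda>\<epsilon>. \<epsilon> powr (5 * \<alpha>))" (is "?E \<in> _")
proof -
  note D = strip_deriv_truncated[OF smooth_strip_deriv smooth_strip_deriv]
  note E = gm_at_res_momentum[OF _ assms(2,3) D D D D, of _ r1 r2 u1 u2 p1 p2]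
  define Q where "Q \<delta> = (let v = r1 \<xi> \<tau> + \<delta> * r2 \<xi> \<tau>; vx = pd1 r1 \<xi> \<tau> + \<delta> * pd1 r2 \<xi> \<tau>;
      vt = pd2 r1 \<xi> \<tau> + \<delta> * pd2 r2 \<xi> \<tau>; w = u1 \<xi> \<tau> + \<delta> * u2 \<xi> \<tau>;
      wx = pd1 u1 \<xi> \<tau> + \<delta> * pd1 u2 \<xi> \<tau>; wt = pd2 u1 \<xi> \<tau> + \<delta> * pd2 u2 \<xi> \<tau>
    in r0 * pd2 u2 \<xi> \<tau> - pd1 (pd1 u2) \<xi> \<tau> - c * (vx * w + v * wx) + \<delta> * (vt * w + v * wt)
      + \<delta>\<^sup>2 * (vx * w\<^sup>2) + 2 * (r0 + \<delta>\<^sup>2 * v) * w * wx)" for \<delta>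
  have "isCont Q 0"
    unfolding Q_def Let_def by (intro continuous_intros)
  moreover have "?E \<epsilon> = (\<epsilon> powr \<alpha>) ^ 5 * Q (\<epsilon> powr \<alpha>)" if "\<epsilon> > 0" for \<epsilon>
  proof -
    define \<delta> where "\<delta> = \<epsilon> powr \<alpha>"
    have "?E \<epsilon> = \<delta> ^ 3 * (pd1 p1 \<xi> \<tau> - c * r0 * pd1 u1 \<xi> \<tau>)
        + \<delta> ^ 4 * (pd1 p2 \<xi> \<tau> - c * r0 * pd1 u2 \<xi> \<tau> + r0 * pd2 u1 \<xi> \<tau> - pd1 (pd1 u1) \<xi> \<tau>)
        + \<delta> ^ 5 * Q \<delta>"
      using smooth that
      by (simp add: E truncated_powers powr_double smooth_strip_pd[OF assms(2)] flip: \<delta>_def)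
        (simp add: Q_def Let_def algebra_simps eval_nat_numeral)
    then show ?thesis by (simp add: 1 2 \<delta>_def)
  qed
  ultimately show ?thesis
    using bigo_at_right_powr[of \<alpha> "\<lambda>_. 1" ?E 5 Q] assms(1) by simp
qed


text \<open>Equations \<open>0\<close>, \<open>1\<close> and \<open>2\<close> balance the orders 0,
  2 and 3 in \<open>\<delta>\<close>. The inertial terms start at orders 4 and 6, so among the terms
  with derivatives only the damping \<open>4/3 * d / R\<close> contributes below order 4.\<close>

lemma res_bubble_bigo:
  assumes "\<alpha> > 0" "open J" "\<tau> \<in> J" "R0 \<noteq> 0" and smooth: "\<forall>f\<in>{R1, R2, u1, u2}. smooth_strip J f"
    and 0: "g0 = p0 + 2 * \<sigma> / R0"
    and 1: "p1 \<xi> \<tau> = g1 \<xi> \<tau> + 2 * \<sigma> / R0\<^sup>2 * R1 \<xi> \<tau>"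
    and 2: "p2 \<xi> \<tau> = g2 \<xi> \<tau> + 4/3 * c * pd1 R1 \<xi> \<tau> / R0 + 2 * \<sigma> / R0\<^sup>2 * R2 \<xi> \<tau>"
  shows "(\<lambda>\<epsilon>. gm_at \<alpha> \<alpha> c \<epsilon> (res_bubble \<sigma> (gm_field \<alpha> \<alpha> c \<epsilon> (truncated (2 * \<alpha>) \<alpha> 0 u1 u2 \<epsilon>))
      (gm_field \<alpha> \<alpha> c \<epsilon> (truncated (2 * \<alpha>) \<alpha> p0 p1 p2 \<epsilon>))
      (gm_field \<alpha> \<alpha> c \<epsilon> (truncated (2 * \<alpha>) \<alpha> g0 g1 g2 \<epsilon>))
      (gm_field \<alpha> \<alpha> c \<epsilon> (truncated (2 * \<alpha>) \<alpha> R0 R1 R2 \<epsilon>))) \<xi> \<tau>)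
    \<in> O[at_right 0](\<lambda>\<epsilon>. \<epsilon> powr (4 * \<alpha>))" (is "?E \<in> _")
proof -
  note D = strip_deriv_truncated[OF smooth_strip_deriv smooth_strip_deriv]
  note E = gm_at_res_bubble[OF _ assms(2,3) D D D D, of _ u1 u2 R1 R2]
  \<comment> \<open>These are the perturbations and their derivatives with the common factor
    \<open>\<delta>\<^sup>2\<close> removed.\<close>
  define y yx yt yxx yxt ytx ytt w wx wt where
    "y = (\<lambda>\<delta>. R1 \<xi> \<tau> + \<delta> * R2 \<xi> \<tau>)"
    "yx = (\<lambda>\<delta>. pd1 R1 \<xi> \<tau> + \<delta> * pd1 R2 \<xi> \<tau>)"
    "yt = (\<lambda>\<delta>. pd2 R1 \<xi> \<tau> + \<delta> * pd2 R2 \<xi> \<tau>)"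
    "yxx = (\<lambda>\<delta>. pd1 (pd1 R1) \<xi> \<tau> + \<delta> * pd1 (pd1 R2) \<xi> \<tau>)"
    "yxt = (\<lambda>\<delta>. pd2 (pd1 R1) \<xi> \<tau> + \<delta> * pd2 (pd1 R2) \<xi> \<tau>)"
    "ytx = (\<lambda>\<delta>. pd1 (pd2 R1) \<xi> \<tau> + \<delta> * pd1 (pd2 R2) \<xi> \<tau>)"
    "ytt = (\<lambda>\<delta>. pd2 (pd2 R1) \<xi> \<tau> + \<delta> * pd2 (pd2 R2) \<xi> \<tau>)"
    "w = (\<lambda>\<delta>. u1 \<xi> \<tau> + \<delta> * u2 \<xi> \<tau>)"
    "wx = (\<lambda>\<delta>. pd1 u1 \<xi> \<tau> + \<delta> * pd1 u2 \<xi> \<tau>)"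
    "wt = (\<lambda>\<delta>. pd2 u1 \<xi> \<tau> + \<delta> * pd2 u2 \<xi> \<tau>)"
  note defs = this
  define R where "R = (\<lambda>\<delta>. R0 + \<delta>\<^sup>2 * y \<delta>)"
  \<comment> \<open>\<open>S\<close> and \<open>d\<close> are the second and first material
    derivatives of the radius, divided by \<open>\<delta> ^ 4\<close> and
    \<open>\<delta> ^ 3\<close>.\<close>
  define S where "S = (\<lambda>\<delta>. \<delta> * (\<delta> * ytt \<delta> + \<delta>\<^sup>2 * wt \<delta> * yx \<delta> + (\<delta>\<^sup>2 * w \<delta> - c) * yxt \<delta>)
    + (\<delta>\<^sup>2 * w \<delta> - c) * (\<delta> * ytx \<delta> + \<delta>\<^sup>2 * wx \<delta> * yx \<delta> + (\<delta>\<^sup>2 * w \<delta> - c) * yxx \<delta>))"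
  define d where "d = (\<lambda>\<delta>. \<delta> * yt \<delta> + (\<delta>\<^sup>2 * w \<delta> - c) * yx \<delta>)"
  text \<open>The summand \<open>4/3 * \<dots>\<close> of \<open>Q\<close> is what remains of \<open>4/3 * d / R\<close> after subtracting its value
    \<open>- 4/3 * c * pd1 R1 \<xi> \<tau> / R0\<close> at \<open>\<delta> = 0\<close> and dividing by \<open>\<delta>\<close>; the last one comes from the
    second-order expansion of \<open>2 * \<sigma> / R\<close>.\<close>
  define Q where "Q = (\<lambda>\<delta>. R \<delta> * S \<delta> + 3/2 * \<delta>\<^sup>2 * (d \<delta>)\<^sup>2
    + 4/3 * ((yt \<delta> + \<delta> * w \<delta> * yx \<delta> - c * pd1 R2 \<xi> \<tau>) / R \<delta>
        + c * pd1 R1 \<xi> \<tau> * \<delta> * y \<delta> / (R0 * R \<delta>))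
    + 2 * \<sigma> * (y \<delta>)\<^sup>2 / (R0\<^sup>2 * R \<delta>))"
  have "isCont Q 0" "isCont R 0" "R 0 \<noteq> 0"
    unfolding Q_def S_def d_def R_def defs using assms(4) by (auto intro!: continuous_intros)
  moreover have "?E \<epsilon> = (\<epsilon> powr \<alpha>) ^ 4 * Q (\<epsilon> powr \<alpha>)" if "\<epsilon> > 0" "R (\<epsilon> powr \<alpha>) \<noteq> 0" for \<epsilon>
  proof -
    define \<delta> where "\<delta> = \<epsilon> powr \<alpha>"
    have R: "R \<delta> \<noteq> 0" using that by (simp add: \<delta>_def)
    have "?E \<epsilon> = (p0 + \<delta>\<^sup>2 * (p1 \<xi> \<tau> + \<delta> * p2 \<xi> \<tau>)) - (g0 + \<delta>\<^sup>2 * (g1 \<xi> \<tau> + \<delta> * g2 \<xi> \<tau>))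
      + R \<delta> * (\<delta> ^ 4 * S \<delta>) + 3/2 * (\<delta> ^ 3 * d \<delta>)\<^sup>2 + 4/3 * (\<delta> ^ 3 * d \<delta> / R \<delta>) + 2 * \<sigma> / R \<delta>"
    proof -
      have "\<delta>\<^sup>2 * (\<delta>\<^sup>2 * yt \<delta>) + \<delta> * ((\<delta>\<^sup>2 * w \<delta> - c) * (\<delta>\<^sup>2 * yx \<delta>)) = \<delta> ^ 3 * d \<delta>"
        by (simp add: d_def algebra_simps eval_nat_numeral)
      moreover have "\<delta>\<^sup>2 * (\<delta>\<^sup>2 * (\<delta>\<^sup>2 * ytt \<delta>) + \<delta> * (\<delta>\<^sup>2 * wt \<delta> * (\<delta>\<^sup>2 * yx \<delta>) + (\<delta>\<^sup>2 * w \<delta> - c) * (\<delta>\<^sup>2 * yxt \<delta>)))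
         + \<delta> * ((\<delta>\<^sup>2 * w \<delta> - c) * (\<delta>\<^sup>2 * (\<delta>\<^sup>2 * ytx \<delta>) + \<delta> * (\<delta>\<^sup>2 * wx \<delta> * (\<delta>\<^sup>2 * yx \<delta>) + (\<delta>\<^sup>2 * w \<delta> - c) * (\<delta>\<^sup>2 * yxx \<delta>))))
         = \<delta> ^ 4 * S \<delta>"
        by (simp add: S_def algebra_simps eval_nat_numeral)
      ultimately show ?thesis
        using smooth that(1)
        by (simp add: E truncated_powers powr_double smooth_strip_pd[OF assms(2)] flip: \<delta>_def)
          (simp add: R_def defs)
    qed
    also have "4/3 * (\<delta> ^ 3 * d \<delta> / R \<delta>) = - (\<delta> ^ 3 * (4/3 * c * pd1 R1 \<xi> \<tau> / R0)) + \<delta> ^ 4 * (4/3 *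
        ((yt \<delta> + \<delta> * w \<delta> * yx \<delta> - c * pd1 R2 \<xi> \<tau>) / R \<delta> + c * pd1 R1 \<xi> \<tau> * \<delta> * y \<delta> / (R0 * R \<delta>)))"
    proof -
      let ?z = "yt \<delta> + \<delta> * w \<delta> * yx \<delta> - c * pd1 R2 \<xi> \<tau>" and ?m = "c * pd1 R1 \<xi> \<tau>"
      have d: "d \<delta> = \<delta> * ?z - ?m"
        by (simp add: d_def defs(2) algebra_simps power2_eq_square)
      \<comment> \<open>An exact identity in place of a Taylor series keeps the remainder
        explicit.\<close>
      have inv: "1 / R \<delta> = 1 / R0 - \<delta>\<^sup>2 * y \<delta> / (R0 * R \<delta>)"
        using R assms(4) by (simp add: field_simps) (simp add: R_def)
      have "4/3 * (\<delta> ^ 3 * d \<delta> / R \<delta>) = 4/3 * (\<delta> ^ 4 * (?z / R \<delta>) - \<delta> ^ 3 * ?m * (1 / R \<delta>))"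
        unfolding d by (simp add: diff_divide_distrib right_diff_distrib eval_nat_numeral mult.assoc)
      then show ?thesis
        unfolding inv by (simp add: right_diff_distrib distrib_left eval_nat_numeral mult_ac)
    qed
    also have "2 * \<sigma> / R \<delta> = 2 * \<sigma> / R0 - 2 * \<sigma> / R0\<^sup>2 * \<delta>\<^sup>2 * y \<delta> + \<delta> ^ 4 * (2 * \<sigma> * (y \<delta>)\<^sup>2 / (R0\<^sup>2 * R \<delta>))"
      using R assms(4) by (simp add: divide_simps) (simp add: R_def eval_nat_numeral algebra_simps)
    \<comment> \<open>The three balance equations enter here: the pressure difference consists of
      precisely the terms that cancel the low orders of surface tension and damping.\<close>
    also have "(p0 + \<delta>\<^sup>2 * (p1 \<xi> \<tau> + \<delta> * p2 \<xi> \<tau>)) - (g0 + \<delta>\<^sup>2 * (g1 \<xi> \<tau> + \<delta> * g2 \<xi> \<tau>)) =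
        - (2 * \<sigma> / R0) + 2 * \<sigma> / R0\<^sup>2 * \<delta>\<^sup>2 * y \<delta> + \<delta> ^ 3 * (4/3 * c * pd1 R1 \<xi> \<tau> / R0)"
      unfolding 0 1 2 defs(1) by (simp add: algebra_simps eval_nat_numeral add_divide_distrib)
    also have "\<dots> + R \<delta> * (\<delta> ^ 4 * S \<delta>) + 3/2 * (\<delta> ^ 3 * d \<delta>)\<^sup>2
        + (- (\<delta> ^ 3 * (4/3 * c * pd1 R1 \<xi> \<tau> / R0)) + \<delta> ^ 4 * B)
        + (2 * \<sigma> / R0 - 2 * \<sigma> / R0\<^sup>2 * \<delta>\<^sup>2 * y \<delta> + \<delta> ^ 4 * C)
      = \<delta> ^ 4 * (R \<delta> * S \<delta> + 3/2 * \<delta>\<^sup>2 * (d \<delta>)\<^sup>2 + B + C)" for B C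
      by (simp add: distrib_left power_mult_distrib)
    finally show ?thesis
      unfolding \<delta>_def[symmetric] Q_def .
  qed
  ultimately show ?thesis
    using bigo_at_right_powr[of \<alpha> R ?E 4 Q] assms(1) by simp
qed

text \<open>At order 2 only heat conduction acts, and \<open>1\<close> says that gas pressure times
  radius cubed is constant to first order, the isothermal law. At order 3, advection and compression
  of the first-order fields force the deviation in \<open>2\<close>.\<close>

lemma res_gas_bigo:
  assumes "\<alpha> > 0" "open J" "\<tau> \<in> J" "R0 \<noteq> 0" "G0 \<noteq> 0" and smooth: "\<forall>f\<in>{R1, R2, G1, G2}. smooth_strip J f"
    and 1: "G1 \<xi> \<tau> / G0 + 3 * R1 \<xi> \<tau> / R0 = 0"
    and 2: "3 * (\<gamma> - 1) * T0 * (G2 \<xi> \<tau> / G0 + 3 * R2 \<xi> \<tau> / R0) =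
      c * (R0 * pd1 G1 \<xi> \<tau> + 3 * \<gamma> * G0 * pd1 R1 \<xi> \<tau>)"
  shows "(\<lambda>\<epsilon>. gm_at \<alpha> \<alpha> c \<epsilon> (res_gas \<gamma> T0 G0 R0 (gm_field \<alpha> \<alpha> c \<epsilon> (truncated (2 * \<alpha>) \<alpha> 0 u1 u2 \<epsilon>))
      (gm_field \<alpha> \<alpha> c \<epsilon> (truncated (2 * \<alpha>) \<alpha> G0 G1 G2 \<epsilon>))
      (gm_field \<alpha> \<alpha> c \<epsilon> (truncated (2 * \<alpha>) \<alpha> R0 R1 R2 \<epsilon>))) \<xi> \<tau>)
    \<in> O[at_right 0](\<lambda>\<epsilon>. \<epsilon> powr (4 * \<alpha>))" (is "?E \<in> _")
proof -
  note D = strip_deriv_truncated[OF smooth_strip_deriv smooth_strip_deriv]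
  note E = gm_at_res_gas[OF _ assms(2,3) D D, of _ G1 G2 R1 R2]
  define y yx yt g gx gt w where
    "y = (\<lambda>\<delta>. R1 \<xi> \<tau> + \<delta> * R2 \<xi> \<tau>)"
    "yx = (\<lambda>\<delta>. pd1 R1 \<xi> \<tau> + \<delta> * pd1 R2 \<xi> \<tau>)"
    "yt = (\<lambda>\<delta>. pd2 R1 \<xi> \<tau> + \<delta> * pd2 R2 \<xi> \<tau>)"
    "g = (\<lambda>\<delta>. G1 \<xi> \<tau> + \<delta> * G2 \<xi> \<tau>)"
    "gx = (\<lambda>\<delta>. pd1 G1 \<xi> \<tau> + \<delta> * pd1 G2 \<xi> \<tau>)"
    "gt = (\<lambda>\<delta>. pd2 G1 \<xi> \<tau> + \<delta> * pd2 G2 \<xi> \<tau>)"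
    "w = (\<lambda>\<delta>. u1 \<xi> \<tau> + \<delta> * u2 \<xi> \<tau>)"
  note defs = this
  define R where "R = (\<lambda>\<delta>. R0 + \<delta>\<^sup>2 * y \<delta>)"
  define dy where "dy = (\<lambda>\<delta>. \<delta> * yt \<delta> + (\<delta>\<^sup>2 * w \<delta> - c) * yx \<delta>)"
  define dg where "dg = (\<lambda>\<delta>. \<delta> * gt \<delta> + (\<delta>\<^sup>2 * w \<delta> - c) * gx \<delta>)"
  \<comment> \<open>\<open>N\<close> is the part of the relative change of pressure times radius
    cubed that is at least quadratic in \<open>g\<close> and \<open>y\<close>, divided by
    \<open>\<delta> ^ 4\<close>.\<close>
  define N where "N = (\<lambda>\<delta>. (3 * g \<delta> * R0\<^sup>2 * y \<delta> + 3 * G0 * R0 * (y \<delta>)\<^sup>2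
    + \<delta>\<^sup>2 * (3 * g \<delta> * R0 * (y \<delta>)\<^sup>2 + G0 * (y \<delta>) ^ 3) + \<delta> ^ 4 * g \<delta> * (y \<delta>) ^ 3) / (G0 * R0 ^ 3))"
  define M where "M = (\<lambda>\<delta>. \<delta> * y \<delta> * dg \<delta> + R0 * (gt \<delta> + \<delta> * w \<delta> * gx \<delta> - c * pd1 G2 \<xi> \<tau>)
    + 3 * \<gamma> * (\<delta> * g \<delta> * dy \<delta> + G0 * (yt \<delta> + \<delta> * w \<delta> * yx \<delta> - c * pd1 R2 \<xi> \<tau>))
    + 3 * (\<gamma> - 1) * T0 * N \<delta>)"
  define Q where "Q = (\<lambda>\<delta>. M \<delta> / R \<delta>)"
  have "isCont Q 0" "isCont R 0" "R 0 \<noteq> 0"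
    unfolding Q_def M_def N_def dy_def dg_def R_def defs using assms(4,5)
    by (auto intro!: continuous_intros)
  moreover have "?E \<epsilon> = (\<epsilon> powr \<alpha>) ^ 4 * Q (\<epsilon> powr \<alpha>)" if "\<epsilon> > 0" "R (\<epsilon> powr \<alpha>) \<noteq> 0" for \<epsilon>
  proof -
    define \<delta> where "\<delta> = \<epsilon> powr \<alpha>"
    have R: "R \<delta> \<noteq> 0" using that by (simp add: \<delta>_def)
    have y: "\<delta>\<^sup>2 * (\<delta>\<^sup>2 * yt \<delta>) + \<delta> * ((\<delta>\<^sup>2 * w \<delta> - c) * (\<delta>\<^sup>2 * yx \<delta>)) = \<delta> ^ 3 * dy \<delta>"
      by (simp add: dy_def algebra_simps eval_nat_numeral)
    have g: "\<delta>\<^sup>2 * (\<delta>\<^sup>2 * gt \<delta>) + \<delta> * ((\<delta>\<^sup>2 * w \<delta> - c) * (\<delta>\<^sup>2 * gx \<delta>)) = \<delta> ^ 3 * dg \<delta>"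
      by (simp add: dg_def algebra_simps eval_nat_numeral)
    have E': "?E \<epsilon> = \<delta> ^ 3 * dg \<delta> + 3 * \<gamma> * (G0 + \<delta>\<^sup>2 * g \<delta>) * (\<delta> ^ 3 * dy \<delta> / R \<delta>)
      + 3 * (\<gamma> - 1) * (T0 / R \<delta>) * ((G0 + \<delta>\<^sup>2 * g \<delta>) * R \<delta> ^ 3 / (G0 * R0 ^ 3) - 1)"
      unfolding y[symmetric] g[symmetric] using smooth that(1)
      by (simp add: E truncated_powers powr_double flip: \<delta>_def) (simp add: R_def defs)
    \<comment> \<open>The denominator is cleared with opaque variables, so the remaining work is on
      \<open>?E \<epsilon> * R \<delta>\<close>, free of division by
      \<open>R \<delta>\<close>.\<close>
    have clear: "(x + a * (e / R \<delta>) + k * (t / R \<delta>) * n) * R \<delta> = R \<delta> * x + a * e + k * t * n"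
      for x a e k t n :: real
      using R by (simp add: field_simps)
    have "?E \<epsilon> * R \<delta> = \<delta> ^ 3 * (R \<delta> * dg \<delta> + 3 * \<gamma> * (G0 + \<delta>\<^sup>2 * g \<delta>) * dy \<delta>)
      + 3 * (\<gamma> - 1) * T0 * ((G0 + \<delta>\<^sup>2 * g \<delta>) * R \<delta> ^ 3 / (G0 * R0 ^ 3) - 1)"
      unfolding E' clear by (simp only: distrib_left mult_ac)
    also have "(G0 + \<delta>\<^sup>2 * g \<delta>) * R \<delta> ^ 3 / (G0 * R0 ^ 3) - 1 =
        \<delta>\<^sup>2 * (g \<delta> / G0 + 3 * y \<delta> / R0) + \<delta> ^ 4 * N \<delta>"
      unfolding R_def N_def using assms(4,5)
      by (simp add: divide_simps) (simp add: algebra_simps eval_nat_numeral)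
    also have "g \<delta> / G0 + 3 * y \<delta> / R0 =
        (G1 \<xi> \<tau> / G0 + 3 * R1 \<xi> \<tau> / R0) + \<delta> * (G2 \<xi> \<tau> / G0 + 3 * R2 \<xi> \<tau> / R0)"
      by (simp add: defs(1,4) add_divide_distrib distrib_left)
    also have "\<delta> ^ 3 * (R \<delta> * dg \<delta> + 3 * \<gamma> * (G0 + \<delta>\<^sup>2 * g \<delta>) * dy \<delta>)
        + 3 * (\<gamma> - 1) * T0 * (\<delta>\<^sup>2 * (\<dots>) + \<delta> ^ 4 * N \<delta>)
      = \<delta> ^ 4 * M \<delta> + \<delta> ^ 3 * (3 * (\<gamma> - 1) * T0 * (G2 \<xi> \<tau> / G0 + 3 * R2 \<xi> \<tau> / R0)
        - c * (R0 * pd1 G1 \<xi> \<tau> + 3 * \<gamma> * G0 * pd1 R1 \<xi> \<tau>))"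
      unfolding 1 M_def R_def
      by (simp add: dg_def dy_def defs(2,5) algebra_simps eval_nat_numeral diff_divide_distrib)
    finally show ?thesis
      using R unfolding 2 Q_def \<delta>_def[symmetric] by (simp add: field_simps)
  qed
  ultimately show ?thesis
    using bigo_at_right_powr[of \<alpha> R ?E 4 Q] assms(1) by simp
qed

text \<open>This residual is algebraic: a polynomial in \<open>\<delta>\<close> with terms of
  degrees 0, 2, 3 and at least 4, of which the three equations remove the first three.\<close>

lemma res_volume_bigo:
  assumes "\<alpha> > 0" and 0: "(1 - X + R0 ^ 3) * r0 = 1"
    and 1: "(1 - X + R0 ^ 3) * r1 \<xi> \<tau> + 3 * R0\<^sup>2 * r0 * R1 \<xi> \<tau> = 0"
    and 2: "(1 - X + R0 ^ 3) * r2 \<xi> \<tau> + 3 * R0\<^sup>2 * r0 * R2 \<xi> \<tau> = 0"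
  shows "(\<lambda>\<epsilon>. gm_at \<alpha> \<alpha> c \<epsilon> (res_volume X (gm_field \<alpha> \<alpha> c \<epsilon> (truncated (2 * \<alpha>) \<alpha> r0 r1 r2 \<epsilon>))
      (gm_field \<alpha> \<alpha> c \<epsilon> (truncated (2 * \<alpha>) \<alpha> R0 R1 R2 \<epsilon>))) \<xi> \<tau>)
    \<in> O[at_right 0](\<lambda>\<epsilon>. \<epsilon> powr (4 * \<alpha>))" (is "?E \<in> _")
proof -
  define v y where "v = (\<lambda>\<delta>. r1 \<xi> \<tau> + \<delta> * r2 \<xi> \<tau>)" "y = (\<lambda>\<delta>. R1 \<xi> \<tau> + \<delta> * R2 \<xi> \<tau>)"
  define Q where "Q = (\<lambda>\<delta>. 3 * R0 * (y \<delta>)\<^sup>2 * r0 + 3 * R0\<^sup>2 * y \<delta> * v \<delta>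
    + \<delta>\<^sup>2 * ((y \<delta>) ^ 3 * r0 + 3 * R0 * (y \<delta>)\<^sup>2 * v \<delta>) + \<delta> ^ 4 * ((y \<delta>) ^ 3 * v \<delta>))"
  have "isCont Q 0"
    unfolding Q_def v_y_def by (intro continuous_intros)
  moreover have "?E \<epsilon> = (\<epsilon> powr \<alpha>) ^ 4 * Q (\<epsilon> powr \<alpha>)" if "\<epsilon> > 0" for \<epsilon>
  proof -
    define \<delta> where "\<delta> = \<epsilon> powr \<alpha>"
    have "?E \<epsilon> = (1 - X + (R0 + \<delta>\<^sup>2 * y \<delta>) ^ 3) * (r0 + \<delta>\<^sup>2 * v \<delta>) - 1"
      using gm_at_gm_field[OF that, of \<alpha> \<alpha> c _ \<xi> \<tau>]
      by (simp add: gm_at_def res_volume_def truncated_powers v_y_def \<delta>_def)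
    also have "\<dots> = ((1 - X + R0 ^ 3) * r0 - 1) + \<delta>\<^sup>2 * ((1 - X + R0 ^ 3) * v \<delta> + 3 * R0\<^sup>2 * r0 * y \<delta>)
        + \<delta> ^ 4 * Q \<delta>"
      by (simp add: Q_def algebra_simps eval_nat_numeral)
    also have "(1 - X + R0 ^ 3) * v \<delta> + 3 * R0\<^sup>2 * r0 * y \<delta> =
      ((1 - X + R0 ^ 3) * r1 \<xi> \<tau> + 3 * R0\<^sup>2 * r0 * R1 \<xi> \<tau>)
        + \<delta> * ((1 - X + R0 ^ 3) * r2 \<xi> \<tau> + 3 * R0\<^sup>2 * r0 * R2 \<xi> \<tau>)"
      by (simp add: v_y_def algebra_simps)
    finally show ?thesis
      unfolding 0 1 2 by (simp add: \<delta>_def)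
  qed
  ultimately show ?thesis
    using bigo_at_right_powr[of \<alpha> "\<lambda>_. 1" ?E 4 Q] assms(1) by simp
qed


section \<open>Second-order fields and the compatibility condition\<close>

theorem mainTheorem8:
  fixes \<alpha> \<beta> k q P0 R0 T0 \<sigma> \<gamma> X s \<rho>0 G0 a0 A :: real
    and J :: "real set"
    and \<rho>1 u1 R1 G1 P1 \<rho>2 :: "real \<Rightarrow> real \<Rightarrow> real"
  assumes "\<alpha> > 0" and "\<beta> = \<alpha>" and "k = \<alpha>" and "q = 2 * \<alpha>"
    and "P0 > 0" and "R0 > 0" and "T0 > 0" and "\<sigma> \<ge> 0" and "\<gamma> > 1" and "0 < X" and "X < 1"
    and "s = R0 ^ 3 - X + 1"
    and "\<rho>0 = 1 / s"
    and "G0 = P0 + 2 * \<sigma> / R0"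
    and "a0 = sqrt (9 * R0 * P0 + 12 * \<sigma>) * s / (3 * R0\<^sup>2)"
    and "A = (P0\<^sup>2 * R0 ^ 5 + R0 ^ 4 * (4 * P0 * \<sigma> + 13/3 * T0) + 4 * R0 ^ 3 * \<sigma>\<^sup>2
              + ((P0 * R0 + 2 * \<sigma>)\<^sup>2 + 4/3 * R0 * T0) * (1 - X)) * s / (6 * R0 ^ 4 * T0)"
    and "open J" and "is_interval J"
    and "smooth_strip J \<rho>1"
    and "\<forall>\<xi>. \<forall>\<tau>\<in>J. pd2 \<rho>1 \<xi> \<tau> = A * pd1 (pd1 \<rho>1) \<xi> \<tau>"
    and "u1 = (\<lambda>\<xi> \<tau>. a0 / \<rho>0 * \<rho>1 \<xi> \<tau>)"
    and "R1 = (\<lambda>\<xi> \<tau>. - (s\<^sup>2 / (3 * R0\<^sup>2)) * \<rho>1 \<xi> \<tau>)"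
    and "G1 = (\<lambda>\<xi> \<tau>. - (3 * (P0 * R0 + 2 * \<sigma>) / R0\<^sup>2) * R1 \<xi> \<tau>)"
    and "P1 = (\<lambda>\<xi> \<tau>. G1 \<xi> \<tau> + 2 * \<sigma> / R0\<^sup>2 * R1 \<xi> \<tau>)"
    and "smooth_strip J \<rho>2"
  shows "\<exists>u2 P2 G2 R2. smooth_strip J u2 \<and> smooth_strip J P2 \<and> smooth_strip J G2 \<and> smooth_strip J R2 \<and>
    (\<forall>\<xi>. \<forall>\<tau>\<in>J.
      let \<rho> = (\<lambda>\<epsilon>. gm_field \<alpha> \<beta> a0 \<epsilon> (truncated q k \<rho>0 \<rho>1 \<rho>2 \<epsilon>));
          u = (\<lambda>\<epsilon>. gm_field \<alpha> \<beta> a0 \<epsilon> (truncated q k 0 u1 u2 \<epsilon>));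
          R = (\<lambda>\<epsilon>. gm_field \<alpha> \<beta> a0 \<epsilon> (truncated q k R0 R1 R2 \<epsilon>));
          P = (\<lambda>\<epsilon>. gm_field \<alpha> \<beta> a0 \<epsilon> (truncated q k P0 P1 P2 \<epsilon>));
          G = (\<lambda>\<epsilon>. gm_field \<alpha> \<beta> a0 \<epsilon> (truncated q k G0 G1 G2 \<epsilon>));
          E1 = (\<lambda>\<epsilon>. gm_at \<alpha> \<beta> a0 \<epsilon> (res_mass (\<rho> \<epsilon>) (u \<epsilon>)) \<xi> \<tau>);
          E2 = (\<lambda>\<epsilon>. gm_at \<alpha> \<beta> a0 \<epsilon> (res_momentum (\<rho> \<epsilon>) (u \<epsilon>) (P \<epsilon>)) \<xi> \<tau>);
          E3 = (\<lambda>\<epsilon>. gm_at \<alpha> \<beta> a0 \<epsilon> (res_bubble \<sigma> (u \<epsilon>) (P \<epsilon>) (G \<epsilon>) (R \<epsilon>)) \<xi> \<tau>);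
          E4 = (\<lambda>\<epsilon>. gm_at \<alpha> \<beta> a0 \<epsilon> (res_gas \<gamma> T0 G0 R0 (u \<epsilon>) (G \<epsilon>) (R \<epsilon>)) \<xi> \<tau>);
          E5 = (\<lambda>\<epsilon>. gm_at \<alpha> \<beta> a0 \<epsilon> (res_volume X (\<rho> \<epsilon>) (R \<epsilon>)) \<xi> \<tau>)
      in (\<forall>E\<in>{E1, E2}. has_eps_coeff E (\<alpha> + q) 0 \<and> has_eps_coeff E (\<alpha> + q + k) 0
            \<and> E \<in> O[at_right 0](\<lambda>\<epsilon>. \<epsilon> powr (5 * \<alpha>)))
       \<and> (\<forall>E\<in>{E3, E4, E5}. has_eps_coeff E q 0 \<and> has_eps_coeff E (q + k) 0
            \<and> E \<in> O[at_right 0](\<lambda>\<epsilon>. \<epsilon> powr (4 * \<alpha>))))"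
proof -
  have R0: "R0 > 0" and T0: "T0 > 0" and \<alpha>: "\<alpha> > 0" and J: "open J"
    and smooth: "smooth_strip J \<rho>1" "smooth_strip J \<rho>2"
    using assms by auto
  have s: "s > 0" using assms(11,12) zero_less_power[OF R0, of 3] by linarith
  have s_eq: "1 - X + R0 ^ 3 = s" using assms(12) by simp
  have G0: "G0 > 0"
    unfolding assms(14) using assms(5,6,8) by (intro add_pos_nonneg) auto
  have G0_R0: "G0 * R0 = P0 * R0 + 2 * \<sigma>"
    unfolding assms(14) using R0 by (simp add: field_simps)
  \<comment> \<open>\<open>K\<close> adds the thermal and the viscous damping of the bubble;
    \<open>- a0 * b * K\<close> will be the coefficient of \<open>pd1 \<rho>1\<close> in
    \<open>P2\<close> forced by the gas and bubble equations.\<close>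
  define K where "K = G0\<^sup>2 / T0 + 4 / (3 * R0)"
  have a0_sq: "a0\<^sup>2 = s\<^sup>2 * (3 * G0 * R0 - 2 * \<sigma>) / (3 * R0 ^ 4)"
  proof -
    have "(sqrt (9 * R0 * P0 + 12 * \<sigma>))\<^sup>2 = 9 * R0 * P0 + 12 * \<sigma>"
      using assms(5,6,8) by simp
    then show ?thesis
      unfolding assms(15) power_divide power_mult_distrib mult.assoc G0_R0
      using R0 by (simp add: field_simps eval_nat_numeral)
  qed
  \<comment> \<open>Substituting \<open>1 - X = s - R0 ^ 3\<close> reveals the structure of
    \<open>A\<close>. The summand \<open>s\<close> stems from liquid viscosity; the number
    \<open>13/3\<close> is its share 3 plus the share \<open>4/3\<close> of bubble damping.\<close>
  have A_eq: "2 * A = s + s\<^sup>2 * K / (3 * R0\<^sup>2)"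
  proof -
    have X: "1 - X = s - R0 ^ 3" using s_eq by simp
    have K: "K = ((P0 * R0 + 2 * \<sigma>)\<^sup>2 + 4/3 * R0 * T0) / (R0\<^sup>2 * T0)"
      unfolding G0_R0[symmetric] K_def using R0 T0 by (simp add: field_simps power2_eq_square)
    show ?thesis
      unfolding assms(16) X K using R0 T0
      by (simp add: divide_simps) (simp add: algebra_simps eval_nat_numeral)
  qed
  \<comment> \<open>Mass and momentum prescribe only \<open>\<xi>\<close>-derivatives. The diffusion
    equation turns \<open>pd2 \<rho>1\<close> into a \<open>\<xi>\<close>-derivative, so both
    integrate explicitly; the integration functions are chosen to be zero.\<close>
  define u2 where "u2 = (\<lambda>\<xi> \<tau>. (s * a0) * \<rho>2 \<xi> \<tau> + (- s * A) * pd1 \<rho>1 \<xi> \<tau>)"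
  define P2 where "P2 = (\<lambda>\<xi> \<tau>. a0\<^sup>2 * \<rho>2 \<xi> \<tau> + (a0 * s - 2 * a0 * A) * pd1 \<rho>1 \<xi> \<tau>)"
  define b where "b = s\<^sup>2 / (3 * R0\<^sup>2)"
  \<comment> \<open>The zero summand, here and in the first-order fields below, fits the shape of
    the linear combination lemmas.\<close>
  define R2 where "R2 = (\<lambda>\<xi> \<tau>. (- b) * \<rho>2 \<xi> \<tau> + 0 * pd1 \<rho>1 \<xi> \<tau>)"
  define G2 where "G2 = (\<lambda>\<xi> \<tau>. (3 * G0 / R0 * b) * \<rho>2 \<xi> \<tau> + (- a0 * G0\<^sup>2 / T0 * b) * pd1 \<rho>1 \<xi> \<tau>)"
  have u1: "u1 = (\<lambda>\<xi> \<tau>. (s * a0) * \<rho>1 \<xi> \<tau> + 0 * \<rho>1 \<xi> \<tau>)"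
    using assms(13,21) by (simp add: mult.commute)
  have R1: "R1 = (\<lambda>\<xi> \<tau>. (- b) * \<rho>1 \<xi> \<tau> + 0 * \<rho>1 \<xi> \<tau>)"
    using assms(22) by (simp add: b_def)
  have G1: "G1 = (\<lambda>\<xi> \<tau>. (3 * G0 / R0 * b) * \<rho>1 \<xi> \<tau> + 0 * \<rho>1 \<xi> \<tau>)"
    unfolding assms(23) R1 G0_R0[symmetric] using R0 by (simp add: power2_eq_square mult.assoc)
  have a0_sq': "a0\<^sup>2 = b * (3 * G0 / R0 - 2 * \<sigma> / R0\<^sup>2)"
    unfolding a0_sq b_def using R0 by (simp add: field_simps eval_nat_numeral)
  have P1: "P1 = (\<lambda>\<xi> \<tau>. a0\<^sup>2 * \<rho>1 \<xi> \<tau> + 0 * \<rho>1 \<xi> \<tau>)"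
    unfolding assms(24) G1 R1 a0_sq' by (simp add: algebra_simps)
  note smooth' = smooth smooth_strip_pd[OF J smooth(1)]
  note lc = smooth_strip_linear_combination[OF J]
  have "smooth_strip J u1" "smooth_strip J R1" "smooth_strip J G1" "smooth_strip J P1"
    unfolding u1 R1 G1 P1 by (intro lc smooth)+
  moreover have smooth2: "smooth_strip J u2" "smooth_strip J P2" "smooth_strip J G2" "smooth_strip J R2"
    unfolding u2_def P2_def G2_def R2_def by (intro lc smooth')+
  ultimately have sm: "smooth_strip J f" if "f \<in> {\<rho>1, \<rho>2, u1, u2, R1, R2, G1, G2, P1, P2}" for f
    using that smooth by blast
  have heat: "pd2 \<rho>1 \<xi> \<tau> = A * pd1 (pd1 \<rho>1) \<xi> \<tau>" if "\<tau> \<in> J" for \<xi> \<tau>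
    using that assms(20) by blast
  have pd_u1: "pd1 u1 \<xi> \<tau> = s * a0 * pd1 \<rho>1 \<xi> \<tau>" "pd2 u1 \<xi> \<tau> = s * a0 * pd2 \<rho>1 \<xi> \<tau>"
    if "\<tau> \<in> J" for \<xi> \<tau>
    unfolding u1 linear_combination_pd[OF smooth(1,1) that] by simp_all
  have pd_pd_u1: "pd1 (pd1 u1) \<xi> \<tau> = s * a0 * pd1 (pd1 \<rho>1) \<xi> \<tau>" if "\<tau> \<in> J" for \<xi> \<tau>
  proof -
    \<comment> \<open>The formula for \<open>pd1 u1\<close> is known only for times in
      \<open>J\<close>, but the outer derivative stays on the line of constant
      \<open>\<tau>\<close>.\<close>
    have "pd1 (pd1 u1) \<xi> \<tau> = deriv (\<lambda>y. s * a0 * pd1 \<rho>1 y \<tau>) \<xi>"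
      using that by (simp add: pd1_def[of "pd1 u1"] pd_u1)
    also have "\<dots> = pd1 (\<lambda>\<xi> \<tau>. s * a0 * pd1 \<rho>1 \<xi> \<tau> + 0 * pd1 \<rho>1 \<xi> \<tau>) \<xi> \<tau>"
      by (simp add: pd1_def)
    finally show ?thesis
      unfolding linear_combination_pd[OF smooth'(3,3) that] by simp
  qed
  have pd_R1: "pd1 R1 \<xi> \<tau> = - b * pd1 \<rho>1 \<xi> \<tau>" if "\<tau> \<in> J" for \<xi> \<tau>
    unfolding R1 linear_combination_pd[OF smooth(1,1) that] by simp
  have pd_G1: "pd1 G1 \<xi> \<tau> = 3 * G0 / R0 * b * pd1 \<rho>1 \<xi> \<tau>" if "\<tau> \<in> J" for \<xi> \<tau>
    unfolding G1 linear_combination_pd[OF smooth(1,1) that] by simp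
  have pd_P1: "pd1 P1 \<xi> \<tau> = a0\<^sup>2 * pd1 \<rho>1 \<xi> \<tau>" if "\<tau> \<in> J" for \<xi> \<tau>
    unfolding P1 linear_combination_pd[OF smooth(1,1) that] by simp
  have pd_u2: "pd1 u2 \<xi> \<tau> = s * a0 * pd1 \<rho>2 \<xi> \<tau> - s * A * pd1 (pd1 \<rho>1) \<xi> \<tau>" if "\<tau> \<in> J" for \<xi> \<tau>
    unfolding u2_def linear_combination_pd[OF smooth'(2,3) that] by simp
  have pd_P2: "pd1 P2 \<xi> \<tau> = a0\<^sup>2 * pd1 \<rho>2 \<xi> \<tau> + (a0 * s - 2 * a0 * A) * pd1 (pd1 \<rho>1) \<xi> \<tau>"
    if "\<tau> \<in> J" for \<xi> \<tau>
    unfolding P2_def linear_combination_pd[OF smooth'(2,3) that] by simp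
  have \<rho>0: "\<rho>0 * s = 1" using s assms(13) by simp
  \<comment> \<open>Both coefficient equations become polynomial identities modulo
    \<open>\<rho>0 * s = 1\<close>.\<close>
  have mass: "(\<lambda>\<epsilon>. gm_at \<alpha> \<alpha> a0 \<epsilon> (res_mass (gm_field \<alpha> \<alpha> a0 \<epsilon> (truncated (2 * \<alpha>) \<alpha> \<rho>0 \<rho>1 \<rho>2 \<epsilon>))
      (gm_field \<alpha> \<alpha> a0 \<epsilon> (truncated (2 * \<alpha>) \<alpha> 0 u1 u2 \<epsilon>))) \<xi> \<tau>)
    \<in> O[at_right 0](\<lambda>\<epsilon>. \<epsilon> powr (5 * \<alpha>))" if "\<tau> \<in> J" for \<xi> \<tau>
    using \<rho>0 by (intro res_mass_bigo[OF \<alpha> J that])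
      (simp_all add: sm pd_u1[OF that] pd_u2[OF that] heat[OF that], algebra+)
  have momentum: "(\<lambda>\<epsilon>. gm_at \<alpha> \<alpha> a0 \<epsilon> (res_momentum
      (gm_field \<alpha> \<alpha> a0 \<epsilon> (truncated (2 * \<alpha>) \<alpha> \<rho>0 \<rho>1 \<rho>2 \<epsilon>))
      (gm_field \<alpha> \<alpha> a0 \<epsilon> (truncated (2 * \<alpha>) \<alpha> 0 u1 u2 \<epsilon>))
      (gm_field \<alpha> \<alpha> a0 \<epsilon> (truncated (2 * \<alpha>) \<alpha> P0 P1 P2 \<epsilon>))) \<xi> \<tau>)
    \<in> O[at_right 0](\<lambda>\<epsilon>. \<epsilon> powr (5 * \<alpha>))" if "\<tau> \<in> J" for \<xi> \<tau>
    using \<rho>0 by (intro res_momentum_bigo[OF \<alpha> J that])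
      (simp_all add: sm pd_u1[OF that] pd_pd_u1[OF that] pd_u2[OF that] pd_P1[OF that] pd_P2[OF that]
        heat[OF that], algebra+)
  have bubble: "(\<lambda>\<epsilon>. gm_at \<alpha> \<alpha> a0 \<epsilon> (res_bubble \<sigma>
      (gm_field \<alpha> \<alpha> a0 \<epsilon> (truncated (2 * \<alpha>) \<alpha> 0 u1 u2 \<epsilon>))
      (gm_field \<alpha> \<alpha> a0 \<epsilon> (truncated (2 * \<alpha>) \<alpha> P0 P1 P2 \<epsilon>))
      (gm_field \<alpha> \<alpha> a0 \<epsilon> (truncated (2 * \<alpha>) \<alpha> G0 G1 G2 \<epsilon>))
      (gm_field \<alpha> \<alpha> a0 \<epsilon> (truncated (2 * \<alpha>) \<alpha> R0 R1 R2 \<epsilon>))) \<xi> \<tau>)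
    \<in> O[at_right 0](\<lambda>\<epsilon>. \<epsilon> powr (4 * \<alpha>))" if "\<tau> \<in> J" for \<xi> \<tau>
  proof (rule res_bubble_bigo[OF \<alpha> J that])
    \<comment> \<open>Compatibility: \<open>P2\<close> was fixed by the momentum equation and must
      now satisfy the bubble equation. Its \<open>\<rho>2\<close> part matches by
      \<open>a0_sq'\<close>, its \<open>pd1 \<rho>1\<close> part by this value of
      \<open>A\<close>.\<close>
    have "2 * A = s + b * K" using A_eq by (simp add: b_def)
    then have "a0 * s - 2 * a0 * A = - (a0 * (b * K))"
      by algebra
    then have c: "a0 * s - 2 * a0 * A = - (a0 * G0\<^sup>2 / T0 * b) - 4/3 * a0 * b / R0"
      by (simp add: K_def algebra_simps)
    show "P2 \<xi> \<tau> = G2 \<xi> \<tau> + 4/3 * a0 * pd1 R1 \<xi> \<tau> / R0 + 2 * \<sigma> / R0\<^sup>2 * R2 \<xi> \<tau>"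
      unfolding P2_def G2_def R2_def pd_R1[OF that] a0_sq' c by (simp add: algebra_simps)
  qed (use R0 sm assms(14,24) in auto)
  have gas: "(\<lambda>\<epsilon>. gm_at \<alpha> \<alpha> a0 \<epsilon> (res_gas \<gamma> T0 G0 R0
      (gm_field \<alpha> \<alpha> a0 \<epsilon> (truncated (2 * \<alpha>) \<alpha> 0 u1 u2 \<epsilon>))
      (gm_field \<alpha> \<alpha> a0 \<epsilon> (truncated (2 * \<alpha>) \<alpha> G0 G1 G2 \<epsilon>))
      (gm_field \<alpha> \<alpha> a0 \<epsilon> (truncated (2 * \<alpha>) \<alpha> R0 R1 R2 \<epsilon>))) \<xi> \<tau>)
    \<in> O[at_right 0](\<lambda>\<epsilon>. \<epsilon> powr (4 * \<alpha>))" if "\<tau> \<in> J" for \<xi> \<tau>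
  proof (rule res_gas_bigo[OF \<alpha> J that])
    show "G1 \<xi> \<tau> / G0 + 3 * R1 \<xi> \<tau> / R0 = 0"
      unfolding G1 R1 using R0 G0 by (simp add: field_simps)
    have "G2 \<xi> \<tau> / G0 + 3 * R2 \<xi> \<tau> / R0 = - a0 * G0 / T0 * b * pd1 \<rho>1 \<xi> \<tau>"
      unfolding G2_def R2_def using R0 G0 T0 by (simp add: field_simps power2_eq_square)
    \<comment> \<open>The first-order relation between \<open>G1\<close> and \<open>R1\<close>
      leaves the factor \<open>1 - \<gamma>\<close> on the right. It cancels, which is why
      \<open>\<gamma>\<close> appears in neither \<open>G2\<close> nor \<open>A\<close>.\<close>
    then show "3 * (\<gamma> - 1) * T0 * (G2 \<xi> \<tau> / G0 + 3 * R2 \<xi> \<tau> / R0) =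
        a0 * (R0 * pd1 G1 \<xi> \<tau> + 3 * \<gamma> * G0 * pd1 R1 \<xi> \<tau>)"
      unfolding pd_G1[OF that] pd_R1[OF that] using R0 T0 by (simp add: algebra_simps)
  qed (use R0 G0 sm in auto)
  have volume: "(\<lambda>\<epsilon>. gm_at \<alpha> \<alpha> a0 \<epsilon> (res_volume X
      (gm_field \<alpha> \<alpha> a0 \<epsilon> (truncated (2 * \<alpha>) \<alpha> \<rho>0 \<rho>1 \<rho>2 \<epsilon>))
      (gm_field \<alpha> \<alpha> a0 \<epsilon> (truncated (2 * \<alpha>) \<alpha> R0 R1 R2 \<epsilon>))) \<xi> \<tau>)
    \<in> O[at_right 0](\<lambda>\<epsilon>. \<epsilon> powr (4 * \<alpha>))" for \<xi> \<tau>
  proof (rule res_volume_bigo[OF \<alpha>])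
    \<comment> \<open>The linearised volume relation is the same at both orders, so one constant
      \<open>b\<close> serves for \<open>R1\<close> and \<open>R2\<close>.\<close>
    have "s = 3 * R0\<^sup>2 * \<rho>0 * b"
      unfolding b_def using R0 s assms(13) by (simp add: power2_eq_square)
    then show "(1 - X + R0 ^ 3) * \<rho>1 \<xi> \<tau> + 3 * R0\<^sup>2 * \<rho>0 * R1 \<xi> \<tau> = 0"
      "(1 - X + R0 ^ 3) * \<rho>2 \<xi> \<tau> + 3 * R0\<^sup>2 * \<rho>0 * R2 \<xi> \<tau> = 0"
      unfolding R1 R2_def s_eq by simp_all
  qed (use \<rho>0 s_eq in \<open>simp add: mult.commute\<close>)
  \<comment> \<open>The bounds imply the coefficient claims, since \<open>3 * \<alpha>\<close> and
    \<open>4 * \<alpha>\<close> lie below \<open>5 * \<alpha>\<close>; likewise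
    \<open>2 * \<alpha>\<close> and \<open>3 * \<alpha>\<close> lie below
    \<open>4 * \<alpha>\<close> in \<open>E345\<close>.\<close>
  have E12: "has_eps_coeff E (\<alpha> + 2 * \<alpha>) 0 \<and> has_eps_coeff E (\<alpha> + 2 * \<alpha> + \<alpha>) 0
      \<and> E \<in> O[at_right 0](\<lambda>\<epsilon>. \<epsilon> powr (5 * \<alpha>))"
    if "E \<in> O[at_right 0](\<lambda>\<epsilon>. \<epsilon> powr (5 * \<alpha>))" for E
    using that \<alpha> by (intro conjI has_eps_coeff_zero[OF that]) auto
  have E345: "has_eps_coeff E (2 * \<alpha>) 0 \<and> has_eps_coeff E (2 * \<alpha> + \<alpha>) 0
      \<and> E \<in> O[at_right 0](\<lambda>\<epsilon>. \<epsilon> powr (4 * \<alpha>))"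
    if "E \<in> O[at_right 0](\<lambda>\<epsilon>. \<epsilon> powr (4 * \<alpha>))" for E
    using that \<alpha> by (intro conjI has_eps_coeff_zero[OF that]) auto
  show ?thesis
    unfolding \<open>\<beta> = \<alpha>\<close> \<open>k = \<alpha>\<close> \<open>q = 2 * \<alpha>\<close> Let_def
    by (rule exI[of _ u2], rule exI[of _ P2], rule exI[of _ G2], rule exI[of _ R2],
        intro conjI smooth2, intro allI, rule ballI)
      (simp only: ball_simps simp_thms E12[OF mass] E12[OF momentum]
        E345[OF bubble] E345[OF gas] E345[OF volume])
qed

end
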